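(* Let $1\leq p<\infty$, $0<\theta<1$, and $\mathbf{w}=(w_n)_{n=1}^\infty=(n^{-\theta})_{n=1}^\infty$. Then $d(\mathbf{w},p)$ admits a 1-complemented subspace isomorphic to $$Y_{\mathbf{w},p}:=\Big(\bigoplus_{N=1}^\infty D_N\Big)_p,$$ where $D_N:=[d_n]_{n=1}^N$ is the linear span in $d(\mathbf{w},p)$ of the first $N$ unit vectors.
   Context: Scalars are $\mathbb{K}\in\{\mathbb{R},\mathbb{C}\}$. The Lorentz sequence space $d(\mathbf{w},p)$ is the space of all scalar sequences $(a_n)_{n=1}^\infty$ with $$\|(a_n)\|_{d(\mathbf{w},p)}:=\sup_{\pi}\Big(\sum_{n=1}^\infty|a_{\pi(n)}|^pw_n\Big)^{1/p}<\infty,$$ the supremum being over all permutations $\pi$ of $\mathbb{N}$; $(d_n)_{n=1}^\infty$ denotes its unit vector basis. $(\bigoplus_N D_N)_p$ is the $\ell_p$-direct sum, with norm $\|(x_N)_N\|=(\sum_N\|x_N\|^p)^{1/p}$. A subspace is 1-complemented if it is the range of a linear projection of norm $1$. Isomorphic means linearly homeomorphic. *)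

theory Defs
  imports "HOL-Analysis.Analysis" "HOL-Library.Function_Algebras"
begin

text \<open>
  The spaces depend on real parameters, so normed spaces are given by an explicit carrier and norm
  inside an ambient additive group. The scalar field \<open>'k\<close> is meant to be \<^typ>\<open>real\<close> or
  \<^typ>\<open>complex\<close>. Sequences are indexed from 0: position \<open>n\<close> stands for \<open>n + 1\<close> of
  the usual notation.
\<close>

record ('k, 'v) normed_sp =
  scl :: "'k \<Rightarrow> 'v \<Rightarrow> 'v"
  pts :: "'v set"
  nrm :: "'v \<Rightarrow> real"

definition linear_map ::
    "('k, 'v::ab_group_add) normed_sp \<Rightarrow> ('k, 'u::ab_group_add) normed_sp \<Rightarrow> ('v \<Rightarrow> 'u) \<Rightarrow> bool" where
  "linear_map X Y T \<longleftrightarrow>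
     T \<in> pts X \<rightarrow> pts Y \<and>
     (\<forall>x\<in>pts X. \<forall>y\<in>pts X. T (x + y) = T x + T y) \<and>
     (\<forall>c. \<forall>x\<in>pts X. T (scl X c x) = scl Y c (T x))"

definition has_op_norm ::
    "('k, 'v) normed_sp \<Rightarrow> ('k, 'u) normed_sp \<Rightarrow> ('v \<Rightarrow> 'u) \<Rightarrow> real \<Rightarrow> bool" where
  "has_op_norm X Y T C \<longleftrightarrow>
     bdd_above ((\<lambda>x. nrm Y (T x)) ` {x \<in> pts X. nrm X x \<le> 1}) \<and>
     (SUP x\<in>{x \<in> pts X. nrm X x \<le> 1}. nrm Y (T x)) = C"

definition one_complemented :: "('k, 'v::ab_group_add) normed_sp \<Rightarrow> 'v set \<Rightarrow> bool" where
  "one_complemented X Z \<longleftrightarrow>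
     (\<exists>P. linear_map X X P \<and> (\<forall>x\<in>pts X. P (P x) = P x) \<and> has_op_norm X X P 1 \<and> P ` pts X = Z)"

text \<open>
  The locale \<^locale>\<open>Metric_space\<close> asks for nonnegativity and symmetry of the distance on the whole type,
  while \<open>nrm\<close> is only meaningful on the carrier; the value 0 off the carrier does not affect the
  topology.
\<close>

definition norm_dist :: "('k, 'v::ab_group_add) normed_sp \<Rightarrow> 'v \<Rightarrow> 'v \<Rightarrow> real" where
  "norm_dist X x y = (if x \<in> pts X \<and> y \<in> pts X then nrm X (x - y) else 0)"

definition norm_topology :: "('k, 'v::ab_group_add) normed_sp \<Rightarrow> 'v topology" where
  "norm_topology X = Metric_space.mtopology (pts X) (norm_dist X)"

definition isomorphic_sp ::
    "('k, 'v::ab_group_add) normed_sp \<Rightarrow> ('k, 'u::ab_group_add) normed_sp \<Rightarrow> bool" where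
  "isomorphic_sp X Y \<longleftrightarrow>
     (\<exists>T. linear_map X Y T \<and> homeomorphic_map (norm_topology X) (norm_topology Y) T)"

definition seq_scale :: "'k::real_normed_field \<Rightarrow> (nat \<Rightarrow> 'k) \<Rightarrow> nat \<Rightarrow> 'k" where
  "seq_scale c a = (\<lambda>n. c * a n)"

text \<open>The library's \<^const>\<open>module.span\<close> is applied to \<open>seq_scale\<close> below.\<close>

lemma vector_space_seq_scale: "vector_space seq_scale"
  by unfold_locales (auto simp: seq_scale_def algebra_simps)

definition lorentz_value ::
    "(nat \<Rightarrow> real) \<Rightarrow> real \<Rightarrow> (nat \<Rightarrow> 'k::real_normed_field) \<Rightarrow> (nat \<Rightarrow> nat) \<Rightarrow> real" where
  "lorentz_value w p a \<pi> = (\<Sum>n. norm (a (\<pi> n)) powr p * w n) powr (1 / p)"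

text \<open>
  Finiteness of the supremum means that every rearranged series converges and that the values
  are bounded.
\<close>

definition lorentz ::
    "(nat \<Rightarrow> real) \<Rightarrow> real \<Rightarrow> ('k::real_normed_field, nat \<Rightarrow> 'k) normed_sp" where
  "lorentz w p =
     \<lparr>scl = seq_scale,
      pts = {a. (\<forall>\<pi>. bij \<pi> \<longrightarrow> summable (\<lambda>n. norm (a (\<pi> n)) powr p * w n)) \<and>
                bdd_above (lorentz_value w p a ` {\<pi>. bij \<pi>})},
      nrm = (\<lambda>a. SUP \<pi>\<in>{\<pi>. bij \<pi>}. lorentz_value w p a \<pi>)\<rparr>"

definition unit_vec :: "nat \<Rightarrow> nat \<Rightarrow> 'k::real_normed_field" where
  "unit_vec n = (\<lambda>i. if i = n then 1 else 0)"

definition lorentz_initial ::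
    "(nat \<Rightarrow> real) \<Rightarrow> real \<Rightarrow> nat \<Rightarrow> ('k::real_normed_field, nat \<Rightarrow> 'k) normed_sp" where
  "lorentz_initial w p N =
     (lorentz w p)\<lparr>pts := module.span seq_scale (unit_vec ` {..<N})\<rparr>"

definition lp_sum ::
    "real \<Rightarrow> (nat \<Rightarrow> ('k, 'v) normed_sp) \<Rightarrow> ('k, nat \<Rightarrow> 'v) normed_sp" where
  "lp_sum p X =
     \<lparr>scl = (\<lambda>c x N. scl (X N) c (x N)),
      pts = {x. (\<forall>N. x N \<in> pts (X N)) \<and> summable (\<lambda>N. nrm (X N) (x N) powr p)},
      nrm = (\<lambda>x. (\<Sum>N. nrm (X N) (x N) powr p) powr (1 / p))\<rparr>"

definition Y_space ::
    "(nat \<Rightarrow> real) \<Rightarrow> real \<Rightarrow> ('k::real_normed_field, nat \<Rightarrow> nat \<Rightarrow> 'k) normed_sp" where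
  "Y_space w p = lp_sum p (\<lambda>N. lorentz_initial w p (Suc N))"

definition power_weight :: "real \<Rightarrow> nat \<Rightarrow> real" where
  "power_weight \<theta> n = real (Suc n) powr (- \<theta>)"

end

theory Submission
  imports Defs "HOL-Combinatorics.Permutations"
begin

text \<open>
  The complemented subspace consists of the sequences that are constant on the blocks of a partition
  of the positions. Averaging over the blocks projects onto it; since the Lorentz norm is invariant
  under permutations and the average over a block is an average of permutations, this projection is a
  contraction (\<open>blockwise_average_contraction\<close>).

  The partition is chosen so that the subspace becomes the direct sum. Level \<open>N\<close> consists of \<open>N + 1\<close>
  consecutive blocks of the same length \<open>K\<close>. Two facts make this work. Inside a level, the weights
  \<open>n\<^sup>-\<^sup>\<theta>\<close> are almost self-similar: the sum over the \<open>i\<close>-th interval of length \<open>K\<close> is comparable to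
  \<open>K\<^sup>1\<^sup>-\<^sup>\<theta> i\<^sup>-\<^sup>\<theta>\<close>, with constants that do not depend on \<open>K\<close>. So the normalised indicators of the blocks of
  one level span a copy of the initial space of dimension \<open>N + 1\<close>, uniformly in \<open>N\<close>. Between levels,
  the length of the blocks of a level exceeds the number of all positions before it. So a level pays
  only a bounded factor for standing behind the earlier ones, and all levels can be arranged optimally at
  the same time; the \<open>p\<close>-th powers of their norms then add up.

  Accordingly there are two estimates between the norm of a block constant sequence and the \<open>p\<close>-sum of
  the norms of its levels. One exhibits a good permutation (\<open>sum_nrm_block_coeffs_le\<close>). The other
  bounds every permutation level by level with the rearrangement inequality
  (\<open>rearranged_sums_le_of_block_coeffs\<close>). Blocks of length \<open>(N + 1)!\<close> satisfy the growth condition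
  and tile all positions without gaps.
\<close>

section \<open>Norms on carriers and their topologies\<close>

text \<open>
  These axioms are what makes \<^const>\<open>norm_dist\<close> a metric; they pass to additive subgroups and
  to \<open>p\<close>-sums.
\<close>

definition normed_group :: "('k, 'v::ab_group_add) normed_sp \<Rightarrow> bool" where
  "normed_group X \<longleftrightarrow>
     0 \<in> pts X \<and>
     (\<forall>x\<in>pts X. - x \<in> pts X \<and> nrm X (- x) = nrm X x \<and> 0 \<le> nrm X x \<and> (nrm X x = 0 \<longleftrightarrow> x = 0)) \<and>
     (\<forall>x\<in>pts X. \<forall>y\<in>pts X. x + y \<in> pts X \<and> nrm X (x + y) \<le> nrm X x + nrm X y)"

lemma normed_groupD:
  assumes "normed_group X"
  shows "0 \<in> pts X"
    and "x \<in> pts X \<Longrightarrow> - x \<in> pts X"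
    and "x \<in> pts X \<Longrightarrow> nrm X (- x) = nrm X x"
    and "x \<in> pts X \<Longrightarrow> 0 \<le> nrm X x"
    and "x \<in> pts X \<Longrightarrow> nrm X x = 0 \<longleftrightarrow> x = 0"
    and "x \<in> pts X \<Longrightarrow> y \<in> pts X \<Longrightarrow> x + y \<in> pts X"
    and "x \<in> pts X \<Longrightarrow> y \<in> pts X \<Longrightarrow> nrm X (x + y) \<le> nrm X x + nrm X y"
  using assms unfolding normed_group_def by blast+

lemma normed_group_diff:
  assumes "normed_group X" "x \<in> pts X" "y \<in> pts X"
  shows "x - y \<in> pts X"
  using normed_groupD(2,6)[OF assms(1)] assms(2,3) by (metis add.commute uminus_add_conv_diff)

lemma normed_group_sum:
  assumes X: "normed_group X" and fin: "finite I" and x: "\<And>i. i \<in> I \<Longrightarrow> x i \<in> pts X"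
  shows "(\<Sum>i\<in>I. x i) \<in> pts X \<and> nrm X (\<Sum>i\<in>I. x i) \<le> (\<Sum>i\<in>I. nrm X (x i))"
  using fin x
proof (induction I rule: finite_induct)
  case empty
  show ?case using normed_groupD(1)[OF X] normed_groupD(5)[OF X, of 0] by simp
next
  case (insert i I)
  then show ?case
    using normed_groupD(6,7)[OF X, of "x i" "\<Sum>i\<in>I. x i"] by fastforce
qed

lemma normed_group_subspace:
  assumes X: "normed_group X" and "Z \<subseteq> pts X" "0 \<in> Z"
    and "\<And>x. x \<in> Z \<Longrightarrow> - x \<in> Z" "\<And>x y. x \<in> Z \<Longrightarrow> y \<in> Z \<Longrightarrow> x + y \<in> Z"
  shows "normed_group (X\<lparr>pts := Z\<rparr>)"
  using assms unfolding normed_group_def by (auto simp: subset_iff)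

lemma Metric_space_norm_dist:
  assumes X: "normed_group X"
  shows "Metric_space (pts X) (norm_dist X)"
proof
  fix x y
  show "0 \<le> norm_dist X x y"
    using normed_groupD(4)[OF X] normed_group_diff[OF X] by (auto simp: norm_dist_def)
  show "norm_dist X x y = norm_dist X y x"
    using normed_groupD(3)[OF X, of "x - y"] normed_group_diff[OF X, of x y]
    by (auto simp: norm_dist_def)
next
  fix x y assume "x \<in> pts X" "y \<in> pts X"
  then show "norm_dist X x y = 0 \<longleftrightarrow> x = y"
    using normed_groupD(5)[OF X, of "x - y"] normed_group_diff[OF X, of x y]
    by (auto simp: norm_dist_def)
next
  fix x y z assume "x \<in> pts X" "y \<in> pts X" "z \<in> pts X"
  then show "norm_dist X x z \<le> norm_dist X x y + norm_dist X y z"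
    using normed_groupD(7)[OF X, of "x - y" "y - z"] normed_group_diff[OF X]
    by (auto simp: norm_dist_def)
qed

lemma continuous_map_norm_topology_of_bounded:
  assumes X: "normed_group X" and Y: "normed_group Y" and T: "T \<in> pts X \<rightarrow> pts Y"
    and diff: "\<And>x y. x \<in> pts X \<Longrightarrow> y \<in> pts X \<Longrightarrow> T (x - y) = T x - T y"
    and bound: "\<And>x. x \<in> pts X \<Longrightarrow> nrm Y (T x) \<le> C * nrm X x"
  shows "continuous_map (norm_topology X) (norm_topology Y) T"
proof -
  have "\<exists>\<delta>>0. \<forall>x. x \<in> pts X \<and> norm_dist X a x < \<delta> \<longrightarrow> norm_dist Y (T a) (T x) < \<epsilon>"
    if a: "a \<in> pts X" and "\<epsilon> > 0" for a \<epsilon>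
  proof (intro exI[of _ "\<epsilon> / (\<bar>C\<bar> + 1)"] conjI allI impI)
    show "0 < \<epsilon> / (\<bar>C\<bar> + 1)" using \<open>\<epsilon> > 0\<close> by simp
    fix x assume x: "x \<in> pts X \<and> norm_dist X a x < \<epsilon> / (\<bar>C\<bar> + 1)"
    have ax: "a - x \<in> pts X" using a x normed_group_diff[OF X] by blast
    have "norm_dist Y (T a) (T x) = nrm Y (T (a - x))"
      using a x T diff by (auto simp: norm_dist_def)
    also have "\<dots> \<le> C * nrm X (a - x)" using bound ax by blast
    also have "\<dots> \<le> (\<bar>C\<bar> + 1) * nrm X (a - x)"
      using normed_groupD(4)[OF X ax] by (intro mult_right_mono) auto
    also have "\<dots> < (\<bar>C\<bar> + 1) * (\<epsilon> / (\<bar>C\<bar> + 1))"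
      using a x by (intro mult_strict_left_mono) (auto simp: norm_dist_def)
    finally show "norm_dist Y (T a) (T x) < \<epsilon>" by simp
  qed
  then show ?thesis
    unfolding norm_topology_def
    using Metric_space.metric_continuous_map[OF Metric_space_norm_dist[OF X] Metric_space_norm_dist[OF Y]] T
    by (simp add: image_subset_iff_funcset)
qed

text \<open>
  The lower bound makes \<open>T\<close> injective, and it is also the bound that makes the inverse
  continuous.
\<close>

lemma isomorphic_spI:
  assumes X: "normed_group X" and Y: "normed_group Y"
    and lin: "linear_map X Y T" and onto: "T ` pts X = pts Y"
    and upper: "\<And>x. x \<in> pts X \<Longrightarrow> nrm Y (T x) \<le> C * nrm X x"
    and lower: "\<And>x. x \<in> pts X \<Longrightarrow> nrm X x \<le> D * nrm Y (T x)"
  shows "isomorphic_sp X Y"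
proof -
  have T: "T \<in> pts X \<rightarrow> pts Y" and add: "\<And>x y. x \<in> pts X \<Longrightarrow> y \<in> pts X \<Longrightarrow> T (x + y) = T x + T y"
    using lin by (auto simp: linear_map_def)
  have diff: "T (x - y) = T x - T y" if "x \<in> pts X" "y \<in> pts X" for x y
    using add[of "x - y" y] that normed_group_diff[OF X that] by (simp add: eq_diff_eq)
  have inj: "inj_on T (pts X)"
  proof
    fix x y assume xy: "x \<in> pts X" "y \<in> pts X" "T x = T y"
    have d: "x - y \<in> pts X" using normed_group_diff[OF X xy(1,2)] .
    have "nrm Y (T (x - y)) = 0"
      using diff[OF xy(1,2)] xy(3) normed_groupD(1)[OF Y] normed_groupD(5)[OF Y, of 0] by simp
    then have "nrm X (x - y) = 0" using lower[OF d] normed_groupD(4)[OF X d] by simp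
    then show "x = y" using normed_groupD(5)[OF X d] by simp
  qed
  define S where "S = inv_into (pts X) T"
  have ST: "S (T x) = x" if "x \<in> pts X" for x using inj that by (simp add: S_def)
  have TS: "T (S y) = y" and S: "S y \<in> pts X" if "y \<in> pts Y" for y
    using onto that by (simp_all add: S_def f_inv_into_f inv_into_into)
  have Sdiff: "S (y - z) = S y - S z" if "y \<in> pts Y" "z \<in> pts Y" for y z
    using ST[of "S y - S z"] diff[of "S y" "S z"] normed_group_diff[OF X, of "S y" "S z"]
      TS[OF that(1)] TS[OF that(2)] S[OF that(1)] S[OF that(2)] by simp
  have "continuous_map (norm_topology X) (norm_topology Y) T"
    by (rule continuous_map_norm_topology_of_bounded[OF X Y T diff upper])
  moreover have "continuous_map (norm_topology Y) (norm_topology X) S"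
  proof (rule continuous_map_norm_topology_of_bounded[OF Y X _ Sdiff, of D])
    show "nrm X (S y) \<le> D * nrm Y y" if "y \<in> pts Y" for y
      using lower[OF S[OF that]] TS[OF that] by simp
  qed (use S in auto)
  moreover have "topspace (norm_topology X) = pts X" "topspace (norm_topology Y) = pts Y"
    by (simp_all add: norm_topology_def Metric_space.topspace_mtopology Metric_space_norm_dist X Y)
  ultimately have "homeomorphic_maps (norm_topology X) (norm_topology Y) T S"
    by (simp add: homeomorphic_maps_def ST TS)
  then show ?thesis
    using lin homeomorphic_map_maps unfolding isomorphic_sp_def by blast
qed

section \<open>Minkowski inequality and \<open>p\<close>-sums\<close>

text \<open>
  Convexity of \<open>\<lambda>x. x powr p\<close> on the open half-line, extended to the end point 0. There it says that
  \<open>u powr p \<le> u\<close> for \<open>0 < u < 1\<close>.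
\<close>

lemma powr_convex_combination:
  fixes a b s t p :: real
  assumes p: "1 \<le> p" and nn: "0 \<le> a" "0 \<le> b" and st: "0 < s" "0 < t" "s + t = 1"
  shows "(s * a + t * b) powr p \<le> s * a powr p + t * b powr p"
proof (cases "a = 0 \<or> b = 0")
  case True
  have le: "(u * x) powr p \<le> u * x powr p" if "0 < u" "u < 1" "0 \<le> x" for u x
  proof -
    have "u powr p \<le> u powr 1" using p that by (intro powr_mono') auto
    then have "u powr p * x powr p \<le> u * x powr p" using that by (intro mult_right_mono) auto
    then show ?thesis using that by (simp add: powr_mult)
  qed
  show ?thesis using True le[of t b] le[of s a] st nn by auto
next
  case False
  moreover have s: "s = 1 - t" using st by simp
  ultimately show ?thesis
    using convex_onD[OF powr_convex[OF p], of t a b] nn st unfolding s by simp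
qed

text \<open>
  With \<open>s = A / (A + B)\<close> and \<open>t = B / (A + B)\<close> the number \<open>(u + v) / (A + B)\<close> is the convex combination
  \<open>s * (u / A) + t * (v / B)\<close>, so convexity of the \<open>p\<close>-th power can be applied term by term. Upper
  bounds \<open>A\<close> and \<open>B\<close> in place of the exact norms keep roots out of the statement, and let them be
  chosen positive even when a norm vanishes.
\<close>

lemma Minkowski_sum:
  fixes u v c :: "'i \<Rightarrow> real" and A B p :: real
  assumes p: "1 \<le> p" and AB: "0 < A" "0 < B"
    and nn: "\<And>i. i \<in> I \<Longrightarrow> 0 \<le> c i" "\<And>i. i \<in> I \<Longrightarrow> 0 \<le> u i" "\<And>i. i \<in> I \<Longrightarrow> 0 \<le> v i"
    and u: "(\<Sum>i\<in>I. u i powr p * c i) \<le> A powr p" and v: "(\<Sum>i\<in>I. v i powr p * c i) \<le> B powr p"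
  shows "(\<Sum>i\<in>I. (u i + v i) powr p * c i) \<le> (A + B) powr p"
proof -
  define s t where "s = A / (A + B)" and "t = B / (A + B)"
  have st: "0 < s" "0 < t" "s + t = 1"
    using AB by (simp_all add: s_def t_def add_divide_distrib[symmetric])
  have pt: "(u i + v i) powr p * c i
      \<le> (A + B) powr p * (s * (u i powr p * c i / A powr p) + t * (v i powr p * c i / B powr p))"
    if i: "i \<in> I" for i
  proof -
    have "u i + v i = (A + B) * (s * (u i / A) + t * (v i / B))"
      using AB by (simp add: s_def t_def distrib_left)
    then have "(u i + v i) powr p = (A + B) powr p * (s * (u i / A) + t * (v i / B)) powr p"
      using AB st nn(2,3)[OF i] by (simp add: powr_mult)
    also have "\<dots> \<le> (A + B) powr p * (s * (u i / A) powr p + t * (v i / B) powr p)"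
      using AB st nn(2,3)[OF i] by (intro mult_left_mono powr_convex_combination[OF p]) auto
    finally have "(u i + v i) powr p * c i
        \<le> (A + B) powr p * (s * (u i / A) powr p + t * (v i / B) powr p) * c i"
      using nn(1)[OF i] by (rule mult_right_mono)
    then show ?thesis using AB nn(2,3)[OF i] by (simp add: powr_divide algebra_simps)
  qed
  have "(\<Sum>i\<in>I. (u i + v i) powr p * c i)
      \<le> (\<Sum>i\<in>I. (A + B) powr p * (s * (u i powr p * c i / A powr p) + t * (v i powr p * c i / B powr p)))"
    by (rule sum_mono[OF pt])
  also have "\<dots> = (A + B) powr p * (s * ((\<Sum>i\<in>I. u i powr p * c i) / A powr p)
      + t * ((\<Sum>i\<in>I. v i powr p * c i) / B powr p))"
    by (simp add: sum_distrib_left[symmetric] sum.distrib sum_divide_distrib[symmetric])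
  also have "\<dots> \<le> (A + B) powr p * (s * 1 + t * 1)"
    using AB st u v by (intro mult_left_mono add_mono) auto
  finally show ?thesis using st by simp
qed

lemma powr_inverse_le_iff:
  fixes x C p :: real
  assumes "0 < p" "0 \<le> x" "0 \<le> C"
  shows "x powr (1 / p) \<le> C \<longleftrightarrow> x \<le> C powr p"
proof -
  have "x powr (1 / p) \<le> C \<longleftrightarrow> (x powr (1 / p)) powr p \<le> C powr p"
    using assms by (metis powr_less_mono2 powr_mono2 less_eq_real_def not_less powr_ge_zero)
  then show ?thesis using assms by (simp add: powr_powr)
qed

lemma powr_powr_inverse: "0 < p \<Longrightarrow> 0 \<le> x \<Longrightarrow> (x powr (1 / p)) powr p = (x::real)"
  by (simp add: powr_powr)

text \<open>
  The triangle inequality is Minkowski's inequality for the partial sums of the numbers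
  \<open>nrm (X N) (x N)\<close>, applied to all bounds strictly above the two norms.
\<close>

lemma normed_group_lp_sum:
  assumes p: "1 \<le> p" and X: "\<And>N. normed_group (X N)"
  shows "normed_group (lp_sum p X)"
proof -
  let ?Y = "lp_sum p X"
  let ?s = "\<lambda>x N. nrm (X N) (x N) powr p"
  have pts: "x \<in> pts ?Y \<longleftrightarrow> (\<forall>N. x N \<in> pts (X N)) \<and> summable (?s x)" for x
    by (simp add: lp_sum_def)
  have nrm: "nrm ?Y x = suminf (?s x) powr (1 / p)" for x by (simp add: lp_sum_def)
  have nn: "0 \<le> nrm (X N) (x N)" if "x \<in> pts ?Y" for x N
    using that normed_groupD(4)[OF X] pts by blast
  have z: "0 \<in> pts ?Y"
    using normed_groupD(1)[OF X] normed_groupD(5)[OF X, OF normed_groupD(1)[OF X]] p by (simp add: pts)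
  have neg: "- x \<in> pts ?Y \<and> nrm ?Y (- x) = nrm ?Y x \<and> 0 \<le> nrm ?Y x \<and> (nrm ?Y x = 0 \<longleftrightarrow> x = 0)"
    if x: "x \<in> pts ?Y" for x
  proof -
    have xN: "x N \<in> pts (X N)" for N using x pts by blast
    have s: "summable (?s x)" using x pts by blast
    have "nrm ?Y x = 0 \<longleftrightarrow> suminf (?s x) = 0" by (simp add: nrm)
    also have "\<dots> \<longleftrightarrow> (\<forall>N. ?s x N = 0)" by (rule suminf_eq_zero_iff[OF s]) simp
    also have "\<dots> \<longleftrightarrow> (\<forall>N. x N = 0)" using normed_groupD(5)[OF X xN] by simp
    also have "\<dots> \<longleftrightarrow> x = 0" by (auto simp: fun_eq_iff)
    finally show ?thesis
      using s normed_groupD(2,3)[OF X xN] by (simp add: pts nrm)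
  qed
  have add: "x + y \<in> pts ?Y \<and> nrm ?Y (x + y) \<le> nrm ?Y x + nrm ?Y y"
    if x: "x \<in> pts ?Y" and y: "y \<in> pts ?Y" for x y
  proof -
    have xN: "x N \<in> pts (X N)" "y N \<in> pts (X N)" for N using x y pts by blast+
    have sx: "summable (?s x)" "summable (?s y)" using x y pts by blast+
    have key: "summable (?s (x + y)) \<and> suminf (?s (x + y)) \<le> (A + B) powr p"
      if A: "nrm ?Y x < A" and B: "nrm ?Y y < B" for A B
    proof -
      have AB: "0 < A" "0 < B"
        using A B neg[OF x] neg[OF y] by linarith+
      have part: "(\<Sum>N<n. ?s z N) \<le> C powr p" if z: "summable (?s z)" and C: "nrm ?Y z < C" "0 < C" for z C n
      proof -
        have "(\<Sum>N<n. ?s z N) \<le> suminf (?s z)" using z by (intro sum_le_suminf) auto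
        also have "\<dots> \<le> C powr p"
          using C p powr_inverse_le_iff[of p "suminf (?s z)" C] suminf_nonneg[OF z] by (simp add: nrm)
        finally show ?thesis .
      qed
      have bound: "(\<Sum>N<n. ?s (x + y) N) \<le> (A + B) powr p" for n
      proof -
        have "(\<Sum>N<n. ?s (x + y) N) \<le> (\<Sum>N<n. (nrm (X N) (x N) + nrm (X N) (y N)) powr p * 1)"
          using normed_groupD(7)[OF X xN] normed_groupD(4)[OF X] normed_groupD(6)[OF X xN] p
          by (intro sum_mono) (auto intro!: powr_mono2)
        also have "\<dots> \<le> (A + B) powr p"
          using part[OF sx(1) A AB(1)] part[OF sx(2) B AB(2)] nn[OF x] nn[OF y]
          by (intro Minkowski_sum[OF p AB]) auto
        finally show ?thesis .
      qed
      have "summable (?s (x + y))"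
        by (rule summableI_nonneg_bounded[OF _ bound]) simp
      then show ?thesis using suminf_le_const[OF _ bound] by simp
    qed
    have mem: "x + y \<in> pts ?Y"
      using key[of "nrm ?Y x + 1" "nrm ?Y y + 1"] normed_groupD(6)[OF X xN] by (simp add: pts)
    have "nrm ?Y (x + y) \<le> nrm ?Y x + nrm ?Y y + e" if "e > 0" for e
    proof -
      have "suminf (?s (x + y)) \<le> (nrm ?Y x + nrm ?Y y + e) powr p"
        using key[of "nrm ?Y x + e / 2" "nrm ?Y y + e / 2"] that by (simp add: algebra_simps)
      moreover have "0 \<le> suminf (?s (x + y))"
        using mem unfolding pts by (intro suminf_nonneg) auto
      moreover have "0 \<le> nrm ?Y x + nrm ?Y y + e" using neg[OF x] neg[OF y] that by linarith
      ultimately show ?thesis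
        using powr_inverse_le_iff[of p "suminf (?s (x + y))" "nrm ?Y x + nrm ?Y y + e"] p
        unfolding nrm[of "x + y"] by linarith
    qed
    then show ?thesis using mem by (auto intro: field_le_epsilon)
  qed
  show ?thesis unfolding normed_group_def using z neg add by blast
qed

section \<open>The Lorentz norm through finite rearranged sums\<close>

text \<open>
  Here \<open>\<pi>\<close> sends an index to the position of the weight it meets, so it is the inverse of the
  permutation in the definition of the Lorentz norm. For \<open>p > 0\<close> and nonnegative weights, membership
  in the space is the existence of some \<open>M\<close> with this property, and the least one is the \<open>p\<close>-th power
  of the norm. In this form norms are estimated through finite sums only.
\<close>

definition rearranged_sums_le ::
    "(nat \<Rightarrow> real) \<Rightarrow> real \<Rightarrow> (nat \<Rightarrow> 'k::real_normed_field) \<Rightarrow> real \<Rightarrow> bool" where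
  "rearranged_sums_le w p a M \<longleftrightarrow>
     (\<forall>\<pi> F. bij \<pi> \<longrightarrow> finite F \<longrightarrow> (\<Sum>j\<in>F. norm (a j) powr p * w (\<pi> j)) \<le> M)"

lemma rearranged_sums_leD:
  "rearranged_sums_le w p a M \<Longrightarrow> bij \<pi> \<Longrightarrow> finite F \<Longrightarrow>
     (\<Sum>j\<in>F. norm (a j) powr p * w (\<pi> j)) \<le> M"
  by (auto simp: rearranged_sums_le_def)

lemma rearranged_sums_le_nonneg: "rearranged_sums_le w p a M \<Longrightarrow> 0 \<le> M"
  using rearranged_sums_leD[of w p a M id "{}"] by simp

lemma lorentz_of_rearranged_sums_le:
  fixes a :: "nat \<Rightarrow> 'k::real_normed_field"
  assumes p: "0 < p" and w: "\<And>n. 0 \<le> w n" and a: "rearranged_sums_le w p a M"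
  shows "a \<in> pts (lorentz w p)" and "nrm (lorentz w p) a powr p \<le> M"
proof -
  have M: "0 \<le> M" using a by (rule rearranged_sums_le_nonneg)
  have part: "(\<Sum>n<m. norm (a (\<pi> n)) powr p * w n) \<le> M" if \<pi>: "bij \<pi>" for \<pi> m
  proof -
    have "(\<Sum>n<m. norm (a (\<pi> n)) powr p * w n) = (\<Sum>j\<in>\<pi> ` {..<m}. norm (a j) powr p * w (inv \<pi> j))"
      using \<pi> by (simp add: sum.reindex inj_on_subset[OF bij_is_inj] bij_is_inj)
    also have "\<dots> \<le> M" using a \<pi> by (intro rearranged_sums_leD bij_imp_bij_inv) auto
    finally show ?thesis .
  qed
  have sm: "summable (\<lambda>n. norm (a (\<pi> n)) powr p * w n)" if "bij \<pi>" for \<pi>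
    by (rule summableI_nonneg_bounded[OF _ part[OF that]]) (simp add: w)
  have val: "lorentz_value w p a \<pi> \<le> M powr (1 / p)" if "bij \<pi>" for \<pi>
    unfolding lorentz_value_def using p suminf_le_const[OF sm[OF that] part[OF that]] w
    by (intro powr_mono2 suminf_nonneg[OF sm[OF that]]) auto
  have bdd: "bdd_above (lorentz_value w p a ` {\<pi>. bij \<pi>})" using val by (auto intro!: bdd_aboveI)
  show "a \<in> pts (lorentz w p)" using sm bdd by (simp add: lorentz_def)
  have ne: "{\<pi>::nat \<Rightarrow> nat. bij \<pi>} \<noteq> {}" using bij_id by blast
  have le: "nrm (lorentz w p) a \<le> M powr (1 / p)"
    unfolding lorentz_def using val ne by (auto intro!: cSUP_least)
  have "0 \<le> lorentz_value w p a id" by (simp add: lorentz_value_def)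
  also have "\<dots> \<le> nrm (lorentz w p) a"
    unfolding lorentz_def using bdd by (auto intro!: cSUP_upper)
  finally have "nrm (lorentz w p) a powr p \<le> (M powr (1 / p)) powr p"
    using le p by (intro powr_mono2) auto
  then show "nrm (lorentz w p) a powr p \<le> M" using p M by (simp add: powr_powr_inverse)
qed

lemma rearranged_sums_le_of_lorentz:
  fixes a :: "nat \<Rightarrow> 'k::real_normed_field"
  assumes p: "0 < p" and w: "\<And>n. 0 \<le> w n" and a: "a \<in> pts (lorentz w p)"
  shows "0 \<le> nrm (lorentz w p) a" and "rearranged_sums_le w p a (nrm (lorentz w p) a powr p)"
proof -
  have sm: "summable (\<lambda>n. norm (a (\<pi> n)) powr p * w n)" if "bij \<pi>" for \<pi>
    using a that by (simp add: lorentz_def)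
  have val: "lorentz_value w p a \<pi> \<le> nrm (lorentz w p) a" if "bij \<pi>" for \<pi>
    using a that unfolding lorentz_def by (auto intro!: cSUP_upper)
  have "0 \<le> lorentz_value w p a id" by (simp add: lorentz_value_def)
  then show nn: "0 \<le> nrm (lorentz w p) a" using val[of id] by simp
  show "rearranged_sums_le w p a (nrm (lorentz w p) a powr p)"
    unfolding rearranged_sums_le_def
  proof (intro allI impI)
    fix \<pi> :: "nat \<Rightarrow> nat" and F :: "nat set" assume \<pi>: "bij \<pi>" and F: "finite F"
    let ?f = "\<lambda>n. norm (a (inv \<pi> n)) powr p * w n"
    have inv: "bij (inv \<pi>)" using \<pi> by (rule bij_imp_bij_inv)
    have "(\<Sum>j\<in>F. norm (a j) powr p * w (\<pi> j)) = sum ?f (\<pi> ` F)"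
      using \<pi> by (simp add: sum.reindex inj_on_subset[OF bij_is_inj] bij_is_inj)
    also have "\<dots> \<le> suminf ?f" using F sm[OF inv] w by (intro sum_le_suminf) auto
    also have "\<dots> = lorentz_value w p a (inv \<pi>) powr p"
      unfolding lorentz_value_def using p w sm[OF inv] by (simp add: powr_powr_inverse suminf_nonneg)
    also have "\<dots> \<le> nrm (lorentz w p) a powr p"
      using val[OF inv] p by (intro powr_mono2) (auto simp: lorentz_value_def)
    finally show "(\<Sum>j\<in>F. norm (a j) powr p * w (\<pi> j)) \<le> nrm (lorentz w p) a powr p" .
  qed
qed

lemma lorentz_nrm_le:
  assumes "0 < p" and "\<And>n. 0 \<le> w n" and "rearranged_sums_le w p a (C powr p)" and "0 \<le> C"
  shows "nrm (lorentz w p) a \<le> C"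
proof (rule ccontr)
  assume "\<not> nrm (lorentz w p) a \<le> C"
  then have "C powr p < nrm (lorentz w p) a powr p" using assms by (intro powr_less_mono2) auto
  then show False using lorentz_of_rearranged_sums_le(2)[OF assms(1-3)] by simp
qed

text \<open>
  The triangle inequality holds because every finite rearranged sum satisfies Minkowski's inequality.
  Definiteness uses \<open>w 0\<close> only: any index can be moved to the position 0.
\<close>

lemma normed_group_lorentz:
  fixes w :: "nat \<Rightarrow> real"
  assumes p: "1 \<le> p" and w: "\<And>n. 0 \<le> w n" and w0: "0 < w 0"
  shows "normed_group (lorentz w p :: ('k::real_normed_field, nat \<Rightarrow> 'k) normed_sp)"
proof -
  let ?X = "lorentz w p :: ('k, nat \<Rightarrow> 'k) normed_sp"
  have p0: "0 < p" using p by simp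
  note into = lorentz_of_rearranged_sums_le[OF p0 w] and out = rearranged_sums_le_of_lorentz[OF p0 w]
  have zero: "rearranged_sums_le w p (0::nat \<Rightarrow> 'k) 0" using p by (simp add: rearranged_sums_le_def)
  have zmem: "0 \<in> pts ?X" by (rule into(1)[OF zero])
  have neg: "- a \<in> pts ?X \<and> nrm ?X (- a) = nrm ?X a" if "a \<in> pts ?X" for a
    using that by (simp add: lorentz_def lorentz_value_def)
  have eq0: "nrm ?X a = 0 \<longleftrightarrow> a = 0" if a: "a \<in> pts ?X" for a
  proof
    assume n0: "nrm ?X a = 0"
    have "a j = 0" for j
    proof -
      \<comment> \<open>The transposition makes the entry \<open>a j\<close> meet the weight \<open>w 0\<close>.\<close>
      have "norm (a j) powr p * w 0 \<le> 0"
        using rearranged_sums_leD[OF out(2)[OF a], of "Transposition.transpose j 0" "{j}"] n0 by simp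
      then have "norm (a j) powr p \<le> 0" using w0 by (simp add: mult_le_0_iff)
      then show ?thesis using powr_ge_zero[of "norm (a j)" p] by simp
    qed
    then show "a = 0" by auto
  next
    assume "a = 0"
    then show "nrm ?X a = 0"
      using lorentz_nrm_le[where a = "0 :: nat \<Rightarrow> 'k" and C = 0 and w = w, OF p0 w] zero out(1)[OF zmem] by simp
  qed
  have add: "a + b \<in> pts ?X \<and> nrm ?X (a + b) \<le> nrm ?X a + nrm ?X b"
    if a: "a \<in> pts ?X" and b: "b \<in> pts ?X" for a b
  proof -
    have key: "rearranged_sums_le w p (a + b) ((A + B) powr p)"
      if A: "nrm ?X a < A" and B: "nrm ?X b < B" for A B
      unfolding rearranged_sums_le_def
    proof (intro allI impI)
      fix \<pi> :: "nat \<Rightarrow> nat" and F :: "nat set" assume \<pi>: "bij \<pi>" and F: "finite F"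
      have AB: "0 < A" "0 < B" using A B out(1)[OF a] out(1)[OF b] by linarith+
      have part: "(\<Sum>j\<in>F. norm (c j) powr p * w (\<pi> j)) \<le> C powr p"
        if "c \<in> pts ?X" "nrm ?X c < C" for c C
      proof -
        have "(\<Sum>j\<in>F. norm (c j) powr p * w (\<pi> j)) \<le> nrm ?X c powr p"
          by (rule rearranged_sums_leD[OF out(2)[OF that(1)] \<pi> F])
        also have "\<dots> \<le> C powr p" using that out(1) p by (intro powr_mono2) auto
        finally show ?thesis .
      qed
      have "(\<Sum>j\<in>F. norm ((a + b) j) powr p * w (\<pi> j))
          \<le> (\<Sum>j\<in>F. (norm (a j) + norm (b j)) powr p * w (\<pi> j))"
        using p w by (intro sum_mono mult_right_mono powr_mono2) (auto simp: norm_triangle_ineq)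
      also have "\<dots> \<le> (A + B) powr p"
        using part[OF a A] part[OF b B] w by (intro Minkowski_sum[OF p AB]) auto
      finally show "(\<Sum>j\<in>F. norm ((a + b) j) powr p * w (\<pi> j)) \<le> (A + B) powr p" .
    qed
    have "nrm ?X (a + b) \<le> nrm ?X a + nrm ?X b + e" if "e > 0" for e
      using lorentz_nrm_le[OF p0 w key[of "nrm ?X a + e / 2" "nrm ?X b + e / 2"]] that
        out(1)[OF a] out(1)[OF b] by (simp add: algebra_simps)
    then have "nrm ?X (a + b) \<le> nrm ?X a + nrm ?X b" by (rule field_le_epsilon)
    then show ?thesis using into(1)[OF key[of "nrm ?X a + 1" "nrm ?X b + 1"]] by simp
  qed
  show ?thesis
    unfolding normed_group_def
  proof (intro conjI ballI)
    show "0 \<in> pts ?X" by (rule zmem)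
  next
    fix a assume a: "a \<in> pts ?X"
    show "- a \<in> pts ?X" and "nrm ?X (- a) = nrm ?X a" using neg[OF a] by simp_all
    show "0 \<le> nrm ?X a" by (rule out(1)[OF a])
    show "nrm ?X a = 0 \<longleftrightarrow> a = 0" by (rule eq0[OF a])
  next
    fix a b assume "a \<in> pts ?X" "b \<in> pts ?X"
    then show "a + b \<in> pts ?X" and "nrm ?X (a + b) \<le> nrm ?X a + nrm ?X b" using add by simp_all
  qed
qed

lemma lorentz_scale:
  fixes a :: "nat \<Rightarrow> 'k::real_normed_field"
  assumes p: "0 < p" and w: "\<And>n. 0 \<le> w n" and a: "a \<in> pts (lorentz w p)"
  shows "seq_scale c a \<in> pts (lorentz w p)"
    and "nrm (lorentz w p) (seq_scale c a) \<le> norm c * nrm (lorentz w p) a"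
proof -
  note out = rearranged_sums_le_of_lorentz[OF p w a]
  have *: "rearranged_sums_le w p (seq_scale c a) ((norm c * nrm (lorentz w p) a) powr p)"
    unfolding rearranged_sums_le_def
  proof (intro allI impI)
    fix \<pi> :: "nat \<Rightarrow> nat" and F :: "nat set" assume *: "bij \<pi>" "finite F"
    have "(\<Sum>j\<in>F. norm (seq_scale c a j) powr p * w (\<pi> j))
        = norm c powr p * (\<Sum>j\<in>F. norm (a j) powr p * w (\<pi> j))"
      by (simp add: seq_scale_def norm_mult powr_mult sum_distrib_left mult_ac)
    also have "\<dots> \<le> norm c powr p * nrm (lorentz w p) a powr p"
      using rearranged_sums_leD[OF out(2) *] by (intro mult_left_mono) auto
    finally show "(\<Sum>j\<in>F. norm (seq_scale c a j) powr p * w (\<pi> j))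
        \<le> (norm c * nrm (lorentz w p) a) powr p"
      using out(1) by (simp add: powr_mult)
  qed
  show "seq_scale c a \<in> pts (lorentz w p)" by (rule lorentz_of_rearranged_sums_le(1)[OF p w *])
  show "nrm (lorentz w p) (seq_scale c a) \<le> norm c * nrm (lorentz w p) a"
    using out(1) by (intro lorentz_nrm_le[OF p w *]) auto
qed

lemma lorentz_permute:
  fixes a :: "nat \<Rightarrow> 'k::real_normed_field"
  assumes p: "0 < p" and w: "\<And>n. 0 \<le> w n" and a: "a \<in> pts (lorentz w p)" and \<tau>: "bij \<tau>"
  shows "a \<circ> \<tau> \<in> pts (lorentz w p)" and "nrm (lorentz w p) (a \<circ> \<tau>) \<le> nrm (lorentz w p) a"
proof -
  note out = rearranged_sums_le_of_lorentz[OF p w a]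
  have *: "rearranged_sums_le w p (a \<circ> \<tau>) (nrm (lorentz w p) a powr p)"
    unfolding rearranged_sums_le_def
  proof (intro allI impI)
    fix \<pi> :: "nat \<Rightarrow> nat" and F :: "nat set" assume *: "bij \<pi>" "finite F"
    have "(\<Sum>j\<in>F. norm ((a \<circ> \<tau>) j) powr p * w (\<pi> j))
        = (\<Sum>j\<in>\<tau> ` F. norm (a j) powr p * w ((\<pi> \<circ> inv \<tau>) j))"
      using \<tau> by (simp add: sum.reindex inj_on_subset[OF bij_is_inj] bij_is_inj)
    also have "\<dots> \<le> nrm (lorentz w p) a powr p"
      using * \<tau> by (intro rearranged_sums_leD[OF out(2)] bij_comp bij_imp_bij_inv) auto
    finally show "(\<Sum>j\<in>F. norm ((a \<circ> \<tau>) j) powr p * w (\<pi> j)) \<le> nrm (lorentz w p) a powr p" .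
  qed
  show "a \<circ> \<tau> \<in> pts (lorentz w p)" by (rule lorentz_of_rearranged_sums_le(1)[OF p w *])
  show "nrm (lorentz w p) (a \<circ> \<tau>) \<le> nrm (lorentz w p) a"
    using out(1) by (intro lorentz_nrm_le[OF p w *]) auto
qed

section \<open>Averaging over blocks\<close>

definition mean_on :: "nat set \<Rightarrow> (nat \<Rightarrow> 'k::real_normed_field) \<Rightarrow> 'k" where
  "mean_on B a = (\<Sum>l\<in>B. a l) / of_nat (card B)"

definition average_block :: "nat set \<Rightarrow> (nat \<Rightarrow> 'k::real_normed_field) \<Rightarrow> nat \<Rightarrow> 'k" where
  "average_block B a = (\<lambda>j. if j \<in> B then mean_on B a else a j)"

text \<open>
  The average of \<open>a \<circ> \<tau>\<close> over all permutations \<open>\<tau>\<close> of \<open>B\<close> is constant on \<open>B\<close>, because composing with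
  a transposition permutes the summands; and it keeps the sum over \<open>B\<close>. So on \<open>B\<close> it is the mean.
  This makes averaging a contraction for every norm that is invariant under permutations.
\<close>

lemma average_block_eq_permutation_average:
  fixes a :: "nat \<Rightarrow> 'k::real_normed_field"
  assumes B: "finite B"
  shows "average_block B a = seq_scale (1 / of_nat (fact (card B))) (\<Sum>\<tau> | \<tau> permutes B. a \<circ> \<tau>)"
proof
  fix j
  define f where "f j = (\<Sum>\<tau> | \<tau> permutes B. a (\<tau> j))" for j
  have card: "card {\<tau>. \<tau> permutes B} = fact (card B)" by (rule card_permutations[OF refl B])
  have "(\<Sum>\<tau>\<in>S. a \<circ> \<tau>) i = (\<Sum>\<tau>\<in>S. a (\<tau> i))" if "finite S" for S i
    using that by (induction rule: finite_induct) auto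
  then have f0: "(\<Sum>\<tau> | \<tau> permutes B. a \<circ> \<tau>) i = f i" for i
    using finite_permutations[OF B] by (simp add: f_def)
  show "average_block B a j
      = seq_scale (1 / of_nat (fact (card B))) (\<Sum>\<tau> | \<tau> permutes B. a \<circ> \<tau>) j"
  proof (cases "j \<in> B")
    case False
    then have "f j = (\<Sum>\<tau> | \<tau> permutes B. a j)"
      unfolding f_def by (intro sum.cong) (auto simp: permutes_not_in)
    then show ?thesis using False card by (simp add: f0 average_block_def seq_scale_def)
  next
    case True
    have const: "f l = f j" if "l \<in> B" for l
    proof -
      have "Transposition.transpose j l permutes B" using True that by (simp add: permutes_swap_id)
      from sum_permutations_compose_right[OF this, of "\<lambda>\<tau>. a (\<tau> j)"]
      show ?thesis by (simp add: f_def)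
    qed
    have card0: "of_nat (card B) \<noteq> (0 :: 'k)" using True B by auto
    have "of_nat (card B) * f j = (\<Sum>l\<in>B. f l)" using const by simp
    also have "\<dots> = (\<Sum>\<tau> | \<tau> permutes B. \<Sum>l\<in>B. a (\<tau> l))" unfolding f_def by (rule sum.swap)
    also have "\<dots> = (\<Sum>\<tau> | \<tau> permutes B. \<Sum>l\<in>B. a l)"
    proof (rule sum.cong[OF refl])
      fix \<tau> assume "\<tau> \<in> {\<tau>. \<tau> permutes B}"
      then show "(\<Sum>l\<in>B. a (\<tau> l)) = (\<Sum>l\<in>B. a l)" using sum.permute[of \<tau> B a] by (simp add: o_def)
    qed
    also have "\<dots> = of_nat (fact (card B)) * (\<Sum>l\<in>B. a l)" using card by simp
    finally have "f j = of_nat (fact (card B)) * (\<Sum>l\<in>B. a l) / of_nat (card B)"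
      using card0 by (simp add: field_simps)
    then show ?thesis using True by (simp add: f0 average_block_def mean_on_def seq_scale_def)
  qed
qed

lemma average_block_contraction:
  fixes a :: "nat \<Rightarrow> 'k::real_normed_field"
  assumes p: "1 \<le> p" and w: "\<And>n. 0 \<le> w n" and w0: "0 < w 0"
    and B: "finite B" and a: "a \<in> pts (lorentz w p)"
  shows "average_block B a \<in> pts (lorentz w p)
    \<and> nrm (lorentz w p) (average_block B a) \<le> nrm (lorentz w p) a"
proof -
  let ?X = "lorentz w p :: ('k, nat \<Rightarrow> 'k) normed_sp"
  let ?S = "\<Sum>\<tau> | \<tau> permutes B. a \<circ> \<tau>"
  have p0: "0 < p" using p by simp
  note perm = lorentz_permute[OF p0 w a permutes_bij]
  have S: "?S \<in> pts ?X \<and> nrm ?X ?S \<le> (\<Sum>\<tau> | \<tau> permutes B. nrm ?X (a \<circ> \<tau>))"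
    using perm finite_permutations[OF B] by (intro normed_group_sum normed_group_lorentz p w w0) auto
  note conjunct2[OF this]
  also have "(\<Sum>\<tau> | \<tau> permutes B. nrm ?X (a \<circ> \<tau>)) \<le> (\<Sum>\<tau> | \<tau> permutes B. nrm ?X a)"
    using perm by (intro sum_mono) auto
  finally have "nrm ?X ?S \<le> fact (card B) * nrm ?X a" 
    using card_permutations[OF refl B] by simp
  then have "norm (1 / of_nat (fact (card B)) :: 'k) * nrm ?X ?S \<le> nrm ?X a"
    by (simp add: norm_divide field_simps)
  then have "nrm ?X (seq_scale (1 / of_nat (fact (card B))) ?S) \<le> nrm ?X a"
    by (rule order_trans[OF lorentz_scale(2)[OF p0 w conjunct1[OF S]]])
  then show ?thesis
    unfolding average_block_eq_permutation_average[OF B]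
    using lorentz_scale(1)[OF p0 w conjunct1[OF S]] by blast
qed

definition blockwise_average :: "(nat \<Rightarrow> nat set) \<Rightarrow> (nat \<Rightarrow> 'k::real_normed_field) \<Rightarrow> nat \<Rightarrow> 'k" where
  "blockwise_average B a = (\<lambda>j. mean_on (B j) a)"

text \<open>
  Finitely many disjoint blocks are averaged one after another: averaging one block does not change
  the mean on another one.
\<close>

lemma averages_contraction:
  fixes a :: "nat \<Rightarrow> 'k::real_normed_field"
  assumes p: "1 \<le> p" and w: "\<And>n. 0 \<le> w n" and w0: "0 < w 0"
    and S: "finite S" and fin: "\<And>C. C \<in> S \<Longrightarrow> finite C" and disj: "disjoint S"
    and a: "a \<in> pts (lorentz w p)"
  shows "\<exists>b\<in>pts (lorentz w p). nrm (lorentz w p) b \<le> nrm (lorentz w p) a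
    \<and> (\<forall>C\<in>S. \<forall>j\<in>C. b j = mean_on C a) \<and> (\<forall>j. j \<notin> \<Union>S \<longrightarrow> b j = a j)"
  using S fin disj
proof (induction S rule: finite_induct)
  case empty
  then show ?case using a by auto
next
  case (insert C S)
  have disj: "disjoint S" "\<And>D. D \<in> S \<Longrightarrow> C \<inter> D = {}"
    using insert.hyps insert.prems by (auto simp: disjoint_def)
  have "finite D" if "D \<in> S" for D using insert.prems(1) that by blast
  from insert.IH[OF this disj(1)] obtain b where b: "b \<in> pts (lorentz w p)" "nrm (lorentz w p) b \<le> nrm (lorentz w p) a"
      "\<And>D j. D \<in> S \<Longrightarrow> j \<in> D \<Longrightarrow> b j = mean_on D a" "\<And>j. j \<notin> \<Union>S \<Longrightarrow> b j = a j"
    by blast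
  have "mean_on C b = mean_on C a"
  proof -
    have "b j = a j" if "j \<in> C" for j using b(4) disj(2) that by blast
    then show ?thesis by (simp add: mean_on_def)
  qed
  then have avg: "average_block C b j = (if j \<in> C then mean_on C a else b j)" for j
    by (simp add: average_block_def)
  have "finite C" using insert.prems by blast
  note con = average_block_contraction[where w = w, OF p w w0 this b(1)]
  show ?case
  proof (intro bexI[of _ "average_block C b"] conjI ballI allI impI)
    show "nrm (lorentz w p) (average_block C b) \<le> nrm (lorentz w p) a" using con b(2) by linarith
    show "average_block C b \<in> pts (lorentz w p)" using con by blast
    fix j D assume "D \<in> insert C S" "j \<in> D"
    then show "average_block C b j = mean_on D a" using avg b(3)[of D j] disj(2)[of D] by auto
  next
    fix j assume "j \<notin> \<Union> (insert C S)"
    then show "average_block C b j = a j" using avg b(4) by simp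
  qed
qed

text \<open>
  A finite rearranged sum meets only finitely many blocks, so infinitely many averages need no limit
  argument.
\<close>

lemma blockwise_average_contraction:
  fixes a :: "nat \<Rightarrow> 'k::real_normed_field"
  assumes p: "1 \<le> p" and w: "\<And>n. 0 \<le> w n" and w0: "0 < w 0"
    and fin: "\<And>j. finite (B j)" and self: "\<And>j. j \<in> B j" and part: "\<And>j l. l \<in> B j \<Longrightarrow> B l = B j"
    and a: "a \<in> pts (lorentz w p)"
  shows "blockwise_average B a \<in> pts (lorentz w p)"
    and "nrm (lorentz w p) (blockwise_average B a) \<le> nrm (lorentz w p) a"
proof -
  have p0: "0 < p" using p by simp
  note out = rearranged_sums_le_of_lorentz[OF p0 w]
  have *: "rearranged_sums_le w p (blockwise_average B a) (nrm (lorentz w p) a powr p)"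
    unfolding rearranged_sums_le_def
  proof (intro allI impI)
    fix \<pi> :: "nat \<Rightarrow> nat" and F :: "nat set" assume \<pi>: "bij \<pi>" and F: "finite F"
    have "disjoint (B ` F)"
      unfolding disjoint_def using part by blast
    then obtain b where b: "b \<in> pts (lorentz w p)" "nrm (lorentz w p) b \<le> nrm (lorentz w p) a"
        "\<And>D j. D \<in> B ` F \<Longrightarrow> j \<in> D \<Longrightarrow> b j = mean_on D a"
      using averages_contraction[where w = w and S = "B ` F" and a = a, OF p w w0] F fin a by blast
    have "blockwise_average B a j = b j" if "j \<in> F" for j
      using b(3)[of "B j" j] self[of j] that by (simp add: blockwise_average_def)
    then have "(\<Sum>j\<in>F. norm (blockwise_average B a j) powr p * w (\<pi> j))
        = (\<Sum>j\<in>F. norm (b j) powr p * w (\<pi> j))"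
      by simp
    also have "\<dots> \<le> nrm (lorentz w p) b powr p"
      by (rule rearranged_sums_leD[OF out(2)[OF b(1)] \<pi> F])
    also have "\<dots> \<le> nrm (lorentz w p) a powr p" using b(2) out(1)[OF b(1)] p by (intro powr_mono2) auto
    finally show "(\<Sum>j\<in>F. norm (blockwise_average B a j) powr p * w (\<pi> j)) \<le> nrm (lorentz w p) a powr p" .
  qed
  show "blockwise_average B a \<in> pts (lorentz w p)" by (rule lorentz_of_rearranged_sums_le(1)[OF p0 w *])
  show "nrm (lorentz w p) (blockwise_average B a) \<le> nrm (lorentz w p) a"
    by (rule lorentz_nrm_le[OF p0 w * out(1)[OF a]])
qed

text \<open>
  The operator norm is attained at the first unit vector: it is fixed, since its block is a singleton,
  and it has norm 1, since no weight exceeds \<open>w 0 = 1\<close>.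
\<close>

lemma one_complemented_blockwise_average:
  fixes B :: "nat \<Rightarrow> nat set" and w :: "nat \<Rightarrow> real"
  assumes p: "1 \<le> p" and w: "\<And>n. 0 \<le> w n" and w0: "w 0 = 1" and w1: "\<And>n. w n \<le> 1"
    and fin: "\<And>j. finite (B j)" and self: "\<And>j. j \<in> B j" and part: "\<And>j l. l \<in> B j \<Longrightarrow> B l = B j"
    and B0: "B 0 = {0}"
  shows "one_complemented (lorentz w p :: ('k::real_normed_field, nat \<Rightarrow> 'k) normed_sp)
           {x \<in> pts (lorentz w p). \<forall>j. \<forall>l\<in>B j. x l = x j}" (is "one_complemented ?X ?Z")
proof -
  let ?P = "blockwise_average B :: (nat \<Rightarrow> 'k) \<Rightarrow> nat \<Rightarrow> 'k"
  have p0: "0 < p" and w00: "0 < w 0" using p w0 by auto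
  have con: "?P x \<in> pts ?X" "nrm ?X (?P x) \<le> nrm ?X x" if "x \<in> pts ?X" for x
    using blockwise_average_contraction[where w = w and B = B and a = x, OF p w w00 fin self] part that
    by blast+
  have fixed: "?P x = x" if "\<forall>j. \<forall>l\<in>B j. x l = x j" for x :: "nat \<Rightarrow> 'k"
  proof
    fix j
    have "(\<Sum>l\<in>B j. x l) = of_nat (card (B j)) * x j" using that by simp
    moreover have "card (B j) \<noteq> 0" using fin[of j] self[of j] by auto
    ultimately show "?P x j = x j" by (simp add: blockwise_average_def mean_on_def)
  qed
  have const: "\<forall>j. \<forall>l\<in>B j. ?P x l = ?P x j" for x
    using part by (auto simp: blockwise_average_def)
  have scl: "scl ?X = seq_scale" by (simp add: lorentz_def)
  have lin: "linear_map ?X ?X ?P"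
    unfolding linear_map_def scl
  proof (intro conjI ballI allI Pi_I ext)
    show "?P x \<in> pts ?X" if "x \<in> pts ?X" for x using con(1) that .
  qed (simp_all add: blockwise_average_def mean_on_def seq_scale_def sum.distrib add_divide_distrib
      sum_distrib_left)
  let ?e = "unit_vec 0 :: nat \<Rightarrow> 'k"
  have Pe: "?P ?e = ?e"
  proof (rule fixed, intro allI ballI)
    fix j l assume "l \<in> B j"
    then have "l = 0 \<longleftrightarrow> j = 0" using part[of l j] self[of j] B0 by (metis singletonD)
    then show "?e l = ?e j" by (simp add: unit_vec_def)
  qed
  have e_le: "rearranged_sums_le w p ?e 1"
    unfolding rearranged_sums_le_def
  proof (intro allI impI)
    fix \<pi> :: "nat \<Rightarrow> nat" and F :: "nat set" assume "bij \<pi>" and F: "finite F"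
    have "(\<Sum>j\<in>F. norm (?e j) powr p * w (\<pi> j)) \<le> (\<Sum>j\<in>F. if j = 0 then w (\<pi> 0) else 0)"
      using p by (intro sum_mono) (auto simp: unit_vec_def)
    also have "\<dots> \<le> 1" using F w1[of "\<pi> 0"] by (simp add: sum.delta)
    finally show "(\<Sum>j\<in>F. norm (?e j) powr p * w (\<pi> j)) \<le> 1" .
  qed
  have e: "?e \<in> pts ?X" by (rule lorentz_of_rearranged_sums_le(1)[OF p0 w e_le])
  have e1: "nrm ?X ?e \<le> 1" using lorentz_nrm_le[where a = ?e and C = 1 and w = w, OF p0 w] e_le by simp
  have "1 \<le> nrm ?X ?e powr p"
    using rearranged_sums_leD[OF rearranged_sums_le_of_lorentz(2)[OF p0 w e], of id "{0}"] w0
    by (simp add: unit_vec_def)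
  then have e2: "1 \<le> nrm ?X ?e"
    using powr_less_mono2[of p "nrm ?X ?e" 1] p0 rearranged_sums_le_of_lorentz(1)[OF p0 w e] by force
  have le1: "nrm ?X (?P x) \<le> 1" if "x \<in> pts ?X" "nrm ?X x \<le> 1" for x
    using con(2)[OF that(1)] that(2) by force
  have bdd: "bdd_above ((\<lambda>x. nrm ?X (?P x)) ` {x \<in> pts ?X. nrm ?X x \<le> 1})"
    using le1 by (auto intro!: bdd_aboveI)
  have "(SUP x\<in>{x \<in> pts ?X. nrm ?X x \<le> 1}. nrm ?X (?P x)) = 1"
  proof (rule antisym)
    show "(SUP x\<in>{x \<in> pts ?X. nrm ?X x \<le> 1}. nrm ?X (?P x)) \<le> 1"
      using e e1 le1 by (intro cSUP_least) auto
    have "1 \<le> nrm ?X (?P ?e)" using Pe e2 by simp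
    also have "\<dots> \<le> (SUP x\<in>{x \<in> pts ?X. nrm ?X x \<le> 1}. nrm ?X (?P x))"
      using e e1 bdd by (intro cSUP_upper) auto
    finally show "1 \<le> (SUP x\<in>{x \<in> pts ?X. nrm ?X x \<le> 1}. nrm ?X (?P x))" .
  qed
  moreover have "?P ` pts ?X = ?Z"
  proof
    show "?P ` pts ?X \<subseteq> ?Z"
    proof (rule image_subsetI)
      fix x assume "x \<in> pts ?X"
      then show "?P x \<in> ?Z" using con(1)[of x] const[of x] by simp
    qed
    show "?Z \<subseteq> ?P ` pts ?X"
    proof
      fix x assume x: "x \<in> ?Z"
      then have "?P x = x" by (intro fixed) simp
      then show "x \<in> ?P ` pts ?X" using x by (intro image_eqI[of _ _ x]) simp_all
    qed
  qed
  moreover have "\<forall>x\<in>pts ?X. ?P (?P x) = ?P x" using fixed[OF const] by simp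
  ultimately show ?thesis
    unfolding one_complemented_def has_op_norm_def using lin bdd
    by (intro exI[of _ ?P] conjI) assumption+
qed

section \<open>Rearrangement and finitely supported sequences\<close>

lemma sum_le_sum_initial:
  fixes w :: "nat \<Rightarrow> real"
  assumes w: "antimono w" and S: "finite S"
  shows "sum w S \<le> (\<Sum>t<card S. w t)"
  using S
proof (induction S rule: finite_linorder_max_induct)
  case empty
  show ?case by simp
next
  case (insert b A)
  then have "A \<subseteq> {..<b}" and "b \<notin> A" by auto
  then have "card A \<le> b" using card_mono[of "{..<b}" A] by simp
  then have "w b \<le> w (card A)" using w by (rule antimonoD[rotated])
  then show ?case using insert \<open>b \<notin> A\<close> by simp
qed

text \<open>
  Subtracting the last, smallest coefficient \<open>b m\<close> from all of them reduces the claim to \<open>m\<close> terms; what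
  was subtracted is \<open>b m\<close> times a sum of \<open>m + 1\<close> distinct weights, which is largest for the first
  \<open>m + 1\<close> ones.
\<close>

lemma rearrangement_inequality:
  fixes b w :: "nat \<Rightarrow> real"
  assumes w: "antimono w" and \<sigma>: "inj_on \<sigma> {..<m}"
    and b: "\<And>s t. s \<le> t \<Longrightarrow> t < m \<Longrightarrow> b t \<le> b s" "\<And>t. t < m \<Longrightarrow> 0 \<le> b t"
  shows "(\<Sum>t<m. b t * w (\<sigma> t)) \<le> (\<Sum>t<m. b t * w t)"
  using \<sigma> b
proof (induction m arbitrary: b)
  case 0
  show ?case by simp
next
  case (Suc m)
  have inj: "inj_on \<sigma> {..<m}" using Suc.prems(1) by (rule inj_on_subset) auto
  have IH: "(\<Sum>t<m. (b t - b m) * w (\<sigma> t)) \<le> (\<Sum>t<m. (b t - b m) * w t)"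
    using Suc.prems by (intro Suc.IH inj) auto
  have "(\<Sum>t<Suc m. w (\<sigma> t)) = sum w (\<sigma> ` {..<Suc m})"
    using Suc.prems(1) by (simp add: sum.reindex del: lessThan_Suc)
  also have "\<dots> \<le> (\<Sum>t<Suc m. w t)"
    using sum_le_sum_initial[OF w, of "\<sigma> ` {..<Suc m}"] Suc.prems(1)
    by (simp add: card_image del: lessThan_Suc)
  finally have last: "b m * (\<Sum>t<Suc m. w (\<sigma> t)) \<le> b m * (\<Sum>t<Suc m. w t)"
    using Suc.prems(3) by (intro mult_left_mono) auto
  have split: "(\<Sum>t<Suc m. b t * v t) = (\<Sum>t<m. (b t - b m) * v t) + b m * (\<Sum>t<Suc m. v t)" for v
    by (simp add: sum_subtractf left_diff_distrib sum_distrib_left distrib_left)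
  show ?case unfolding split using IH last by (rule add_mono)
qed

text \<open>
  Move a minimal entry to the last place and sort the remaining ones.
\<close>

lemma ex_sorting_permutation:
  fixes a :: "nat \<Rightarrow> real"
  shows "\<exists>\<tau>. \<tau> permutes {..<n} \<and> (\<forall>s t. s \<le> t \<longrightarrow> t < n \<longrightarrow> a (\<tau> t) \<le> a (\<tau> s))"
proof (induction n arbitrary: a)
  case 0
  show ?case by (intro exI[of _ id]) (simp add: fun_eq_iff)
next
  case (Suc n)
  obtain i where i: "i \<le> n" "\<And>t. t \<le> n \<Longrightarrow> a i \<le> a t"
    using ex_is_arg_min_if_finite[of "{..n}" a] by (force simp: is_arg_min_linorder)
  let ?q = "Transposition.transpose i n"
  have q: "?q permutes {..<Suc n}" using i by (intro permutes_swap_id) auto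
  obtain \<tau> where \<tau>: "\<tau> permutes {..<n}" "\<forall>s t. s \<le> t \<longrightarrow> t < n \<longrightarrow> a (?q (\<tau> t)) \<le> a (?q (\<tau> s))"
    using Suc[of "a \<circ> ?q"] by auto
  have \<tau>': "\<tau> permutes {..<Suc n}" using \<tau>(1) by (rule permutes_subset) auto
  have n: "\<tau> n = n" using \<tau>(1) by (simp add: permutes_def)
  have "a ((?q \<circ> \<tau>) t) \<le> a ((?q \<circ> \<tau>) s)" if st: "s \<le> t" "t < Suc n" for s t
  proof (cases "t = n")
    case True
    have "?q (\<tau> s) \<in> {..<Suc n}"
      using permutes_in_image[OF q] permutes_in_image[OF \<tau>'] st by simp
    then show ?thesis using True n i(2)[of "?q (\<tau> s)"] by simp
  next
    case False
    then show ?thesis using \<tau>(2) st by simp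
  qed
  then show ?case using permutes_compose[OF \<tau>' q] by blast
qed

text \<open>
  The supremum over all permutations is attained by the decreasing arrangement. This explicit value
  replaces the supremum in both estimates below.
\<close>

lemma lorentz_nrm_eq_sorted_sum:
  fixes y :: "nat \<Rightarrow> 'k::real_normed_field"
  assumes p: "0 < p" and w: "\<And>i. 0 \<le> w i" "antimono w" and y: "\<And>i. n \<le> i \<Longrightarrow> y i = 0"
    and \<tau>: "\<tau> permutes {..<n}"
    and sorted: "\<And>s t. s \<le> t \<Longrightarrow> t < n \<Longrightarrow> norm (y (\<tau> t)) \<le> norm (y (\<tau> s))"
  shows "y \<in> pts (lorentz w p)"
    and "nrm (lorentz w p) y powr p = (\<Sum>i<n. norm (y (\<tau> i)) powr p * w i)"
proof -
  let ?M = "\<Sum>i<n. norm (y (\<tau> i)) powr p * w i"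
  have le: "rearranged_sums_le w p y ?M"
    unfolding rearranged_sums_le_def
  proof (intro allI impI)
    fix \<pi> :: "nat \<Rightarrow> nat" and F :: "nat set" assume \<pi>: "bij \<pi>" and F: "finite F"
    have "(\<Sum>j\<in>F. norm (y j) powr p * w (\<pi> j)) = (\<Sum>j\<in>F \<inter> {..<n}. norm (y j) powr p * w (\<pi> j))"
    proof (intro sum.mono_neutral_right ballI)
      fix j assume "j \<in> F - F \<inter> {..<n}"
      then have "n \<le> j" by auto
      then show "norm (y j) powr p * w (\<pi> j) = 0" using y[of j] by simp
    qed (use F in auto)
    also have "\<dots> \<le> (\<Sum>j<n. norm (y j) powr p * w (\<pi> j))"
      using w(1) by (intro sum_mono2) auto
    also have "\<dots> = (\<Sum>i<n. norm (y (\<tau> i)) powr p * w (\<pi> (\<tau> i)))"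
      using sum.permute[OF \<tau>, of "\<lambda>j. norm (y j) powr p * w (\<pi> j)"] by (simp add: o_def)
    also have "\<dots> \<le> ?M"
    proof (rule rearrangement_inequality[OF w(2)])
      have "inj (\<lambda>i. \<pi> (\<tau> i))" using inj_compose[OF bij_is_inj[OF \<pi>] permutes_inj[OF \<tau>]] by (simp add: o_def)
      then show "inj_on (\<lambda>i. \<pi> (\<tau> i)) {..<n}" by (rule inj_on_subset) simp
      show "norm (y (\<tau> t)) powr p \<le> norm (y (\<tau> s)) powr p" if "s \<le> t" "t < n" for s t
        using sorted[OF that] p by (intro powr_mono2) auto
    qed simp
    finally show "(\<Sum>j\<in>F. norm (y j) powr p * w (\<pi> j)) \<le> ?M" .
  qed
  show y_pts: "y \<in> pts (lorentz w p)" by (rule lorentz_of_rearranged_sums_le(1)[OF p w(1) le])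
  \<comment> \<open>The value is attained: \<open>inv \<tau>\<close> sends the \<open>i\<close>-th largest entry to the position \<open>i\<close>.\<close>
  have "?M = (\<Sum>j<n. norm (y j) powr p * w (inv \<tau> j))"
    using sum.permute[OF \<tau>, of "\<lambda>j. norm (y j) powr p * w (inv \<tau> j)"] permutes_inverses[OF \<tau>]
    by (simp add: o_def)
  also have "\<dots> \<le> nrm (lorentz w p) y powr p"
    using permutes_bij[OF \<tau>]
    by (intro rearranged_sums_leD[OF rearranged_sums_le_of_lorentz(2)[OF p w(1) y_pts]] bij_imp_bij_inv) auto
  finally show "nrm (lorentz w p) y powr p = ?M"
    using lorentz_of_rearranged_sums_le(2)[OF p w(1) le] by simp
qed

lemma ex_sorted_norm_formula:
  fixes y :: "nat \<Rightarrow> 'k::real_normed_field"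
  assumes "0 < p" and "\<And>i. 0 \<le> w i" "antimono w" and "\<And>i. n \<le> i \<Longrightarrow> y i = 0"
  shows "\<exists>\<tau>. \<tau> permutes {..<n} \<and> (\<forall>s t. s \<le> t \<longrightarrow> t < n \<longrightarrow> norm (y (\<tau> t)) \<le> norm (y (\<tau> s)))
    \<and> nrm (lorentz w p) y powr p = (\<Sum>i<n. norm (y (\<tau> i)) powr p * w i)"
proof -
  obtain \<tau> where \<tau>: "\<tau> permutes {..<n}"
      and sorted: "\<forall>s t. s \<le> t \<longrightarrow> t < n \<longrightarrow> norm (y (\<tau> t)) \<le> norm (y (\<tau> s))"
    using ex_sorting_permutation[of n "\<lambda>i. norm (y i)"] by blast
  have "nrm (lorentz w p) y powr p = (\<Sum>i<n. norm (y (\<tau> i)) powr p * w i)"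
    by (rule lorentz_nrm_eq_sorted_sum(2)[OF assms \<tau>]) (use sorted in blast)+
  then show ?thesis using \<tau> sorted by (intro exI[of _ \<tau>] conjI)
qed

lemma span_unit_vec:
  "module.span seq_scale (unit_vec ` {..<n}) = {a :: nat \<Rightarrow> 'k::real_normed_field. \<forall>i\<ge>n. a i = 0}"
    (is "_ = ?A")
proof -
  interpret vector_space "seq_scale :: 'k \<Rightarrow> (nat \<Rightarrow> 'k) \<Rightarrow> nat \<Rightarrow> 'k" by (rule vector_space_seq_scale)
  show ?thesis
  proof
    have "subspace ?A" by (auto simp: subspace_def seq_scale_def)
    moreover have "unit_vec ` {..<n} \<subseteq> ?A" by (auto simp: unit_vec_def)
    ultimately show "span (unit_vec ` {..<n}) \<subseteq> ?A" by (intro span_minimal)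
    show "?A \<subseteq> span (unit_vec ` {..<n})"
    proof
      fix a :: "nat \<Rightarrow> 'k" assume a: "a \<in> ?A"
      have "(\<Sum>i\<in>S. seq_scale (a i) (unit_vec i)) j = (if j \<in> S then a j else 0)" if "finite S" for S j
        using that by (induction rule: finite_induct) (auto simp: seq_scale_def unit_vec_def)
      then have "a = (\<Sum>i<n. seq_scale (a i) (unit_vec i))" using a by (auto simp: fun_eq_iff)
      moreover have "\<dots> \<in> span (unit_vec ` {..<n})"
        by (intro span_sum span_scale span_base) auto
      ultimately show "a \<in> span (unit_vec ` {..<n})" by simp
    qed
  qed
qed

lemma pts_lorentz_initial:
  "pts (lorentz_initial w p n :: ('k::real_normed_field, nat \<Rightarrow> 'k) normed_sp) = {a. \<forall>i\<ge>n. a i = 0}"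
  by (simp add: lorentz_initial_def span_unit_vec)

lemma nrm_lorentz_initial: "nrm (lorentz_initial w p n) = nrm (lorentz w p)"
  by (simp add: lorentz_initial_def)

lemma normed_group_lorentz_initial:
  assumes p: "1 \<le> p" and w: "\<And>i. 0 \<le> w i" "antimono w" "0 < w 0"
  shows "normed_group (lorentz_initial w p n :: ('k::real_normed_field, nat \<Rightarrow> 'k) normed_sp)"
proof -
  have p0: "0 < p" using p by simp
  have sub: "{a. \<forall>i\<ge>n. a i = 0} \<subseteq> pts (lorentz w p :: ('k, nat \<Rightarrow> 'k) normed_sp)"
  proof
    fix y :: "nat \<Rightarrow> 'k" assume "y \<in> {a. \<forall>i\<ge>n. a i = 0}"
    then have y: "\<And>i. n \<le> i \<Longrightarrow> y i = 0" by simp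
    obtain \<tau> where \<tau>: "\<tau> permutes {..<n}"
        and sorted: "\<forall>s t. s \<le> t \<longrightarrow> t < n \<longrightarrow> norm (y (\<tau> t)) \<le> norm (y (\<tau> s))"
      using ex_sorting_permutation[of n "\<lambda>i. norm (y i)"] by blast
    show "y \<in> pts (lorentz w p)"
      by (rule lorentz_nrm_eq_sorted_sum(1)[OF p0 w(1,2) y \<tau>]) (use sorted in blast)+
  qed
  have X: "normed_group (lorentz w p :: ('k, nat \<Rightarrow> 'k) normed_sp)"
    by (rule normed_group_lorentz[where w = w, OF p w(1,3)])
  show ?thesis
    unfolding lorentz_initial_def span_unit_vec by (rule normed_group_subspace[OF X sub]) simp_all
qed

section \<open>Estimates for power weights\<close>

lemma power_weight_nonneg: "0 \<le> power_weight \<theta> n"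
  by (simp add: power_weight_def)

lemma power_weight_0: "power_weight \<theta> 0 = 1"
  by (simp add: power_weight_def)

lemma antimono_power_weight: "0 \<le> \<theta> \<Longrightarrow> antimono (power_weight \<theta>)"
  unfolding power_weight_def by (intro antimonoI powr_mono2') auto

lemma power_weight_le_1: "0 \<le> \<theta> \<Longrightarrow> power_weight \<theta> n \<le> 1"
  using antimonoD[OF antimono_power_weight, of \<theta> 0 n] by (simp add: power_weight_0)

text \<open>
  The weights vary by at most the factor \<open>2 powr \<theta> \<le> 2\<close> when the position is doubled.
\<close>

lemma powr_le_twice_power_weight:
  assumes \<theta>: "0 \<le> \<theta>" "\<theta> \<le> 1" and c: "real (Suc t) \<le> 2 * c"
  shows "c powr (- \<theta>) \<le> 2 * power_weight \<theta> t"
proof -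
  have c0: "0 < c" using c by linarith
  have "(2::real) powr (-1) \<le> 2 powr (- \<theta>)" using \<theta> by (intro powr_mono) auto
  then have "1 / 2 * c powr (- \<theta>) \<le> 2 powr (- \<theta>) * c powr (- \<theta>)"
    by (intro mult_right_mono) (simp_all add: powr_minus)
  also have "\<dots> = (2 * c) powr (- \<theta>)" using c0 by (simp add: powr_mult)
  also have "\<dots> \<le> power_weight \<theta> t"
    unfolding power_weight_def using \<theta> c by (intro powr_mono2') auto
  finally show ?thesis by simp
qed

text \<open>
  Comparison with the integral of \<open>z powr (- \<theta>)\<close> over \<open>{0..K}\<close>, one unit interval at a time.
\<close>

lemma sum_power_weight_initial_le:
  assumes \<theta>: "0 < \<theta>" "\<theta> < 1"
  shows "(\<Sum>t<K. power_weight \<theta> t) \<le> real K powr (1 - \<theta>) / (1 - \<theta>)"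
proof (induction K)
  case 0
  show ?case by simp
next
  case (Suc K)
  have "(1 - \<theta>) * power_weight \<theta> K \<le> real (Suc K) powr (1 - \<theta>) - real K powr (1 - \<theta>)"
  proof (cases "K = 0")
    case True
    then show ?thesis using \<theta> by (simp add: power_weight_0)
  next
    case False
    have "\<exists>z. real K < z \<and> z < real (Suc K) \<and>
        real (Suc K) powr (1 - \<theta>) - real K powr (1 - \<theta>)
          = (real (Suc K) - real K) * ((1 - \<theta>) * z powr (- \<theta>))"
    proof (rule MVT2)
      fix z assume "real K \<le> z" "z \<le> real (Suc K)"
      then show "((\<lambda>z. z powr (1 - \<theta>)) has_real_derivative (1 - \<theta>) * z powr (- \<theta>)) (at z)"
        using False by (auto intro!: derivative_eq_intros)
    qed simp
    then obtain z where z: "real K < z" "z < real (Suc K)"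
      "real (Suc K) powr (1 - \<theta>) - real K powr (1 - \<theta>) = (1 - \<theta>) * z powr (- \<theta>)"
      by auto
    have "power_weight \<theta> K \<le> z powr (- \<theta>)"
      unfolding power_weight_def using z \<theta> by (intro powr_mono2') auto
    then show ?thesis using z(3) \<theta> by simp
  qed
  then have "power_weight \<theta> K \<le> real (Suc K) powr (1 - \<theta>) / (1 - \<theta>) - real K powr (1 - \<theta>) / (1 - \<theta>)"
    using \<theta> by (simp add: diff_divide_distrib[symmetric] pos_le_divide_eq mult.commute)
  then show ?case using Suc by simp
qed

text \<open>
  The constant does not depend on \<open>K\<close>. For \<open>i > 0\<close> the weights on the interval are comparable to each
  other; on the first interval they are not, and only their sum is controlled, which is where
  \<open>\<theta> < 1\<close> enters.
\<close>

lemma sum_power_weight_block_le: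
  assumes \<theta>: "0 < \<theta>" "\<theta> < 1" and K: "0 < K"
  shows "(\<Sum>t\<in>{i * K..<i * K + K}. power_weight \<theta> t)
    \<le> 2 / (1 - \<theta>) * (real K powr (1 - \<theta>) * power_weight \<theta> i)"
proof (cases "i = 0")
  case True
  have "real K powr (1 - \<theta>) / (1 - \<theta>) \<le> 2 / (1 - \<theta>) * real K powr (1 - \<theta>)"
    using \<theta> by (simp add: divide_right_mono)
  then show ?thesis
    using True sum_power_weight_initial_le[OF \<theta>, of K] by (simp add: power_weight_0 lessThan_atLeast0)
next
  case False
  have "power_weight \<theta> t \<le> real K powr (- \<theta>) * (2 * power_weight \<theta> i)" if "t \<in> {i * K..<i * K + K}" for t
  proof -
    have "real (i * K) \<le> real (Suc t)" using that by (simp only: of_nat_le_iff) simp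
    then have "power_weight \<theta> t \<le> (real i * real K) powr (- \<theta>)"
      unfolding power_weight_def using \<theta> False K by (intro powr_mono2') auto
    also have "\<dots> = real K powr (- \<theta>) * real i powr (- \<theta>)" by (simp add: powr_mult)
    also have "\<dots> \<le> real K powr (- \<theta>) * (2 * power_weight \<theta> i)"
      using \<theta> False by (intro mult_left_mono powr_le_twice_power_weight) auto
    finally show ?thesis .
  qed
  then have "(\<Sum>t\<in>{i * K..<i * K + K}. power_weight \<theta> t)
      \<le> (\<Sum>t\<in>{i * K..<i * K + K}. real K powr (- \<theta>) * (2 * power_weight \<theta> i))"
    by (rule sum_mono)
  also have "\<dots> = 2 * (real K powr (1 - \<theta>) * power_weight \<theta> i)"
    using K by (simp add: powr_diff powr_minus field_simps)
  also have "\<dots> \<le> 2 / (1 - \<theta>) * (real K powr (1 - \<theta>) * power_weight \<theta> i)"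
    using \<theta> by (intro mult_right_mono) (auto simp: power_weight_nonneg field_simps)
  finally show ?thesis .
qed

section \<open>A factorial partition of the positions\<close>

text \<open>
  In the numbering from 1, level \<open>N\<close> consists of the positions from \<open>(N + 1)!\<close> up to \<open>(N + 2)! - 1\<close>,
  and it is cut into the \<open>N + 1\<close> blocks of length \<open>(N + 1)!\<close> that start at the positions
  \<open>(i + 1) * (N + 1)!\<close> for \<open>i \<le> N\<close>. So the levels exhaust all positions, and in front of a level there
  are fewer positions than a single block of this level has.
\<close>

definition block_length :: "nat \<Rightarrow> nat" where
  "block_length N = fact (Suc N)"

text \<open>
  The \<open>t\<close>-th entry of the \<open>i\<close>-th block of level \<open>N\<close>; the final \<open>- 1\<close> passes to the numbering
  from 0. The functions \<open>level\<close>, \<open>slot\<close> and \<open>offset\<close> below are the three components of the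
  inverse.
\<close>

definition position :: "nat \<Rightarrow> nat \<Rightarrow> nat \<Rightarrow> nat" where
  "position N i t = Suc i * block_length N + t - 1"

definition level :: "nat \<Rightarrow> nat" where
  "level j = (LEAST N. Suc j < block_length (Suc N))"

definition slot :: "nat \<Rightarrow> nat" where
  "slot j = Suc j div block_length (level j) - 1"

definition offset :: "nat \<Rightarrow> nat" where
  "offset j = Suc j mod block_length (level j)"

lemma block_length_pos [simp]: "0 < block_length N"
  by (simp add: block_length_def)

lemma block_length_Suc: "block_length (Suc N) = Suc (Suc N) * block_length N"
  by (simp add: block_length_def)

lemma block_length_mono: "M \<le> N \<Longrightarrow> block_length M \<le> block_length N"
  unfolding block_length_def by (intro fact_mono_nat) simp

lemma Suc_position: "Suc (position N i t) = Suc i * block_length N + t"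
  using block_length_pos[of N] by (simp add: position_def)

lemma level_eqI:
  assumes "block_length N \<le> Suc j" "Suc j < block_length (Suc N)"
  shows "level j = N"
  unfolding level_def
proof (rule Least_equality)
  fix M assume "Suc j < block_length (Suc M)"
  then show "N \<le> M"
    using assms(1) block_length_mono[of "Suc M" N] by (meson leD le_trans not_less_eq_eq)
qed (rule assms(2))

lemma level_bounds: "block_length (level j) \<le> Suc j" "Suc j < block_length (Suc (level j))"
proof -
  have "Suc j < block_length (Suc j)"
    unfolding block_length_def using fact_ge_self[of "Suc j"] by (simp add: less_le_trans[of _ "Suc (Suc j)"])
  then show upper: "Suc j < block_length (Suc (level j))" unfolding level_def by (rule LeastI)
  show "block_length (level j) \<le> Suc j"
  proof (cases "level j")
    case 0
    then show ?thesis by (simp add: block_length_def)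
  next
    case (Suc M)
    then have "\<not> Suc j < block_length (Suc M)" unfolding level_def by (intro not_less_Least) simp
    then show ?thesis using Suc by simp
  qed
qed

lemma position_coordinates:
  assumes "i \<le> N" "t < block_length N"
  shows "level (position N i t) = N" "slot (position N i t) = i" "offset (position N i t) = t"
proof -
  have "Suc i * block_length N \<le> Suc N * block_length N"
    using assms(1) by (intro mult_right_mono) auto
  then have "Suc i * block_length N + t < block_length (Suc N)"
    using assms(2) unfolding block_length_Suc mult_Suc[of "Suc N"] by linarith
  then show l: "level (position N i t) = N" by (intro level_eqI) (simp_all add: Suc_position)
  show "slot (position N i t) = i" "offset (position N i t) = t"
    unfolding slot_def offset_def l Suc_position using assms(2) by (simp_all only: div_mult_self3 mod_mult_self3) simp_all
qed

lemma coordinates_bounds: "slot j \<le> level j" "offset j < block_length (level j)"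
proof -
  have "Suc j div block_length (level j) < Suc (Suc (level j))"
    using level_bounds(2)[of j] by (intro less_mult_imp_div_less) (simp add: block_length_Suc)
  then show "slot j \<le> level j" by (simp add: slot_def)
  show "offset j < block_length (level j)" by (simp add: offset_def)
qed

lemma position_level_slot_offset [simp]: "position (level j) (slot j) (offset j) = j"
proof -
  have "0 < Suc j div block_length (level j)"
    using level_bounds(1)[of j] by (simp add: div_greater_zero_iff)
  then have "Suc (slot j) = Suc j div block_length (level j)" by (simp add: slot_def)
  then have "Suc (position (level j) (slot j) (offset j)) = Suc j"
    unfolding Suc_position offset_def by (simp only: div_mult_mod_eq)
  then show ?thesis by simp
qed

lemma sum_levels:
  assumes S: "finite S"
  shows "finite {j. level j \<in> S}"
    and "sum h {j. level j \<in> S} = (\<Sum>N\<in>S. \<Sum>i<Suc N. \<Sum>t<block_length N. h (position N i t))"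
proof -
  let ?I = "SIGMA N:S. SIGMA i:{..<Suc N}. {..<block_length N}"
  have bij: "bij_betw (\<lambda>(N, i, t). position N i t) ?I {j. level j \<in> S}"
    by (rule bij_betw_byWitness[where f' = "\<lambda>j. (level j, slot j, offset j)"])
      (auto simp: position_coordinates coordinates_bounds less_Suc_eq_le)
  have fin: "finite ?I" using S by auto
  then show "finite {j. level j \<in> S}" using bij_betw_finite[OF bij] by simp
  have "sum h {j. level j \<in> S} = (\<Sum>(N, i, t)\<in>?I. h (position N i t))"
    using sum.reindex_bij_betw[OF bij, of h] by (simp add: case_prod_unfold)
  also have "\<dots> = (\<Sum>N\<in>S. \<Sum>i<Suc N. \<Sum>t<block_length N. h (position N i t))"
    using S by (simp add: sum.Sigma case_prod_unfold del: sum.lessThan_Suc lessThan_Suc)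
  finally show "sum h {j. level j \<in> S} = (\<Sum>N\<in>S. \<Sum>i<Suc N. \<Sum>t<block_length N. h (position N i t))" .
qed

lemma bij_permute_slots:
  assumes g: "\<And>N. g N permutes {..<Suc N}"
  shows "bij (\<lambda>j. position (level j) (g (level j) (slot j)) (offset j))"
proof -
  \<comment> \<open>\<open>R f\<close> moves the block \<open>i\<close> of level \<open>N\<close> to the block \<open>f N i\<close>, so \<open>R (inv \<circ> g)\<close> undoes \<open>R g\<close>.\<close>
  define R where "R f j = position (level j) (f (level j) (slot j)) (offset j)" for f :: "nat \<Rightarrow> nat \<Rightarrow> nat" and j
  have inv: "R f (R f' j) = j"
    if f: "\<And>N. f N permutes {..<Suc N}" "\<And>N. f' N permutes {..<Suc N}" "\<And>N i. f N (f' N i) = i" for f f' j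
  proof -
    have "f' (level j) (slot j) \<le> level j"
      using permutes_in_image[OF f(2)[of "level j"], of "slot j"] coordinates_bounds(1)[of j] by simp
    then show ?thesis by (simp add: R_def position_coordinates coordinates_bounds(2) f(3))
  qed
  let ?g' = "\<lambda>N. inv (g N)"
  have "R g \<circ> R ?g' = id" "R ?g' \<circ> R g = id"
    using inv[of g ?g'] inv[of ?g' g] g permutes_inv[OF g] permutes_inverses[OF g] by (auto simp: fun_eq_iff)
  then have "bij (R g)" by (intro o_bij)
  then show ?thesis by (simp add: R_def[abs_def])
qed

lemma sum_div_mod:
  fixes g :: "nat \<Rightarrow> nat \<Rightarrow> 'a::comm_monoid_add"
  shows "(\<Sum>s<n * K. g (s div K) (s mod K)) = (\<Sum>i<n. \<Sum>t<K. g i t)"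
proof -
  have "(\<Sum>s\<in>{i * K..<i * K + K}. g (s div K) (s mod K)) = (\<Sum>t<K. g i t)" for i
  proof (rule sum.reindex_bij_witness[where i = "\<lambda>t. i * K + t" and j = "\<lambda>s. s - i * K"])
    fix s assume s: "s \<in> {i * K..<i * K + K}"
    then obtain t where t: "s = i * K + t" "t < K" by (metis add_less_cancel_left atLeastLessThan_iff le_Suc_ex)
    show "g i (s - i * K) = g (s div K) (s mod K)" using t by simp
    show "i * K + (s - i * K) = s" "s - i * K \<in> {..<K}" using t by auto
  qed auto
  then show ?thesis unfolding sum.nat_group[symmetric] by simp
qed

definition block :: "nat \<Rightarrow> nat set" where
  "block j = {l. level l = level j \<and> slot l = slot j}"

lemma finite_block: "finite (block j)"
  by (rule finite_subset[OF _ sum_levels(1)[of "{level j}"]]) (auto simp: block_def)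

lemma block_0: "block 0 = {0}"
proof -
  have l: "level 0 = 0" by (rule level_eqI) (simp_all add: block_length_def)
  have "l = 0" if "level l = 0" "slot l = 0" for l
    using position_level_slot_offset[of l] coordinates_bounds(2)[of l] that by (simp add: position_def block_length_def)
  then show ?thesis using l by (auto simp: block_def slot_def block_length_def)
qed

section \<open>Norm estimates for block constant sequences\<close>

definition block_constant :: "(nat \<Rightarrow> 'k) \<Rightarrow> bool" where
  "block_constant x \<longleftrightarrow> (\<forall>j. \<forall>l\<in>block j. x l = x j)"

lemma block_constant_position:
  assumes "block_constant x" "i \<le> N" "t < block_length N"
  shows "x (position N i t) = x (position N i 0)"
proof -
  have "position N i t \<in> block (position N i 0)" using assms(2,3) by (simp add: block_def position_coordinates)
  then show ?thesis using assms(1) by (auto simp: block_constant_def)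
qed

text \<open>
  A block indicator of level \<open>N\<close> placed on the first positions has \<open>p\<close>-th power norm comparable to
  \<open>block_length N powr (1 - \<theta>)\<close>. The factor normalises it, so the coefficients of a block constant
  sequence refer to normalised block vectors.
\<close>

definition block_factor :: "real \<Rightarrow> real \<Rightarrow> nat \<Rightarrow> real" where
  "block_factor \<theta> p N = real (block_length N) powr ((1 - \<theta>) / p)"

definition block_coeffs :: "real \<Rightarrow> real \<Rightarrow> (nat \<Rightarrow> 'k::real_normed_field) \<Rightarrow> nat \<Rightarrow> nat \<Rightarrow> 'k" where
  "block_coeffs \<theta> p x N i = (if i \<le> N then of_real (block_factor \<theta> p N) * x (position N i 0) else 0)"

lemma block_factor_pos: "0 < block_factor \<theta> p N"
  using block_length_pos[of N] by (simp add: block_factor_def)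

lemma norm_block_coeffs_powr:
  assumes "0 < p" "i \<le> N"
  shows "norm (block_coeffs \<theta> p x N i) powr p
    = real (block_length N) powr (1 - \<theta>) * norm (x (position N i 0)) powr p"
  using assms block_factor_pos[of \<theta> p N]
  by (simp add: block_coeffs_def norm_mult powr_mult) (simp add: block_factor_def powr_powr)

text \<open>
  For each level take the permutation of its blocks that sorts the coefficients decreasingly, and
  leave every level in its place. Since fewer positions than one block precede a level, the weights
  that meet the \<open>i\<close>-th block in the new order are still at least half of
  \<open>block_length N powr (- \<theta>) * power_weight \<theta> i\<close>. So this single rearrangement of the whole sequence
  realises, up to the factor 2, the norms of all levels at the same time.
\<close>

lemma sum_nrm_block_coeffs_le:
  fixes x :: "nat \<Rightarrow> 'k::real_normed_field"
  assumes p: "0 < p" and \<theta>: "0 < \<theta>" "\<theta> < 1" and x: "block_constant x"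
    and M: "rearranged_sums_le (power_weight \<theta>) p x M"
  shows "(\<Sum>N<n. nrm (lorentz (power_weight \<theta>) p) (block_coeffs \<theta> p x N) powr p) \<le> 2 * M"
proof -
  let ?w = "power_weight \<theta>"
  have "\<exists>\<tau>. \<tau> permutes {..<Suc N}
      \<and> nrm (lorentz ?w p) (block_coeffs \<theta> p x N) powr p = (\<Sum>i<Suc N. norm (block_coeffs \<theta> p x N (\<tau> i)) powr p * ?w i)" for N
    using ex_sorted_norm_formula[where w = ?w and n = "Suc N" and y = "block_coeffs \<theta> p x N", OF p power_weight_nonneg
      antimono_power_weight] \<theta> by (auto simp: block_coeffs_def)
  then obtain \<tau> where \<tau>: "\<And>N. \<tau> N permutes {..<Suc N}"
      and norm_\<tau>: "\<And>N. nrm (lorentz ?w p) (block_coeffs \<theta> p x N) powr p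
        = (\<Sum>i<Suc N. norm (block_coeffs \<theta> p x N (\<tau> N i)) powr p * ?w i)"
    by metis
  \<comment> \<open>The block whose coefficient is the \<open>i\<close>-th largest of its level moves to the slot \<open>i\<close>.\<close>
  define \<rho> where "\<rho> j = position (level j) (inv (\<tau> (level j)) (slot j)) (offset j)" for j
  have \<rho>: "bij \<rho>"
    unfolding \<rho>_def using bij_permute_slots[of "\<lambda>N. inv (\<tau> N)"] permutes_inv[OF \<tau>] by simp
  have weight: "real (block_length N) powr (- \<theta>) * ?w i \<le> 2 * ?w (position N i t)" if "t < block_length N" for N i t
  proof -
    have "Suc (position N i t) \<le> 2 * (Suc i * block_length N)" using that by (simp add: Suc_position)
    then have "real (Suc (position N i t)) \<le> real (2 * (Suc i * block_length N))" by (simp only: of_nat_le_iff)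
    then have "(real (Suc i) * real (block_length N)) powr (- \<theta>) \<le> 2 * ?w (position N i t)"
      using \<theta> by (intro powr_le_twice_power_weight) (simp_all only: of_nat_mult of_nat_numeral)
    then show ?thesis by (simp add: powr_mult power_weight_def mult.commute)
  qed
  have group: "nrm (lorentz ?w p) (block_coeffs \<theta> p x N) powr p
      \<le> 2 * (\<Sum>i<Suc N. \<Sum>t<block_length N. norm (x (position N i t)) powr p * ?w (\<rho> (position N i t)))" for N
  proof -
    let ?K = "real (block_length N)"
    have "nrm (lorentz ?w p) (block_coeffs \<theta> p x N) powr p
        = (\<Sum>i<Suc N. norm (block_coeffs \<theta> p x N i) powr p * ?w (inv (\<tau> N) i))"
      unfolding norm_\<tau>
      using sum.permute[OF \<tau>, of "\<lambda>i. norm (block_coeffs \<theta> p x N i) powr p * ?w (inv (\<tau> N) i)" N]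
        permutes_inverses[OF \<tau>] by (simp add: o_def)
    also have "\<dots> \<le> (\<Sum>i<Suc N. 2 * (\<Sum>t<block_length N. norm (x (position N i t)) powr p * ?w (\<rho> (position N i t))))"
    proof (rule sum_mono)
      fix i assume i: "i \<in> {..<Suc N}"
      have "norm (block_coeffs \<theta> p x N i) powr p * ?w (inv (\<tau> N) i)
          = (\<Sum>t<block_length N. norm (x (position N i 0)) powr p * (?K powr (- \<theta>) * ?w (inv (\<tau> N) i)))"
        using i by (simp add: norm_block_coeffs_powr[OF p] powr_diff powr_minus field_simps)
      also have "\<dots> \<le> (\<Sum>t<block_length N. 2 * (norm (x (position N i t)) powr p * ?w (\<rho> (position N i t))))"
      proof (rule sum_mono)
        fix t assume t: "t \<in> {..<block_length N}"
        have "\<rho> (position N i t) = position N (inv (\<tau> N) i) t" using i t by (simp add: \<rho>_def position_coordinates)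
        moreover have "x (position N i t) = x (position N i 0)" using i t by (intro block_constant_position[OF x]) auto
        moreover have "norm (x (position N i 0)) powr p * (?K powr (- \<theta>) * ?w (inv (\<tau> N) i))
            \<le> norm (x (position N i 0)) powr p * (2 * ?w (position N (inv (\<tau> N) i) t))"
          using t by (intro mult_left_mono weight) auto
        ultimately show "norm (x (position N i 0)) powr p * (?K powr (- \<theta>) * ?w (inv (\<tau> N) i))
            \<le> 2 * (norm (x (position N i t)) powr p * ?w (\<rho> (position N i t)))" by (simp only: mult.left_commute)
      qed
      finally show "norm (block_coeffs \<theta> p x N i) powr p * ?w (inv (\<tau> N) i)
          \<le> 2 * (\<Sum>t<block_length N. norm (x (position N i t)) powr p * ?w (\<rho> (position N i t)))"
        by (simp only: sum_distrib_left)
    qed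
    finally show ?thesis by (simp only: sum_distrib_left)
  qed
  have "(\<Sum>N<n. nrm (lorentz ?w p) (block_coeffs \<theta> p x N) powr p)
      \<le> (\<Sum>N<n. 2 * (\<Sum>i<Suc N. \<Sum>t<block_length N. norm (x (position N i t)) powr p * ?w (\<rho> (position N i t))))"
    by (rule sum_mono[OF group])
  also have "\<dots> = 2 * (\<Sum>j | level j \<in> {..<n}. norm (x j) powr p * ?w (\<rho> j))"
    by (simp only: sum_levels(2)[OF finite_lessThan] sum_distrib_left)
  also have "\<dots> \<le> 2 * M"
    using rearranged_sums_leD[OF M \<rho> sum_levels(1)[OF finite_lessThan]] by simp
  finally show ?thesis .
qed

text \<open>
  Under any permutation each level contributes at most what it would contribute on the first
  positions in decreasing order. There the \<open>i\<close>-th largest block meets the \<open>i\<close>-th interval of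
  length \<open>block_length N\<close>, whose weights have been summed above.
\<close>

lemma rearranged_sums_le_of_block_coeffs:
  fixes x :: "nat \<Rightarrow> 'k::real_normed_field"
  assumes p: "0 < p" and \<theta>: "0 < \<theta>" "\<theta> < 1" and x: "block_constant x"
    and sm: "summable (\<lambda>N. nrm (lorentz (power_weight \<theta>) p) (block_coeffs \<theta> p x N) powr p)"
  shows "rearranged_sums_le (power_weight \<theta>) p x
    (2 / (1 - \<theta>) * (\<Sum>N. nrm (lorentz (power_weight \<theta>) p) (block_coeffs \<theta> p x N) powr p))"
  unfolding rearranged_sums_le_def
proof (intro allI impI)
  fix \<pi> :: "nat \<Rightarrow> nat" and F :: "nat set" assume \<pi>: "bij \<pi>" and F: "finite F"
  let ?w = "power_weight \<theta>"
  let ?s = "\<lambda>N. nrm (lorentz (power_weight \<theta>) p) (block_coeffs \<theta> p x N) powr p"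
  have group: "(\<Sum>i<Suc N. \<Sum>t<block_length N. norm (x (position N i t)) powr p * ?w (\<pi> (position N i t)))
      \<le> 2 / (1 - \<theta>) * ?s N" for N
  proof -
    let ?K = "block_length N"
    have "\<exists>\<tau>. \<tau> permutes {..<Suc N}
        \<and> (\<forall>s t. s \<le> t \<longrightarrow> t < Suc N \<longrightarrow> norm (block_coeffs \<theta> p x N (\<tau> t)) \<le> norm (block_coeffs \<theta> p x N (\<tau> s)))
        \<and> ?s N = (\<Sum>i<Suc N. norm (block_coeffs \<theta> p x N (\<tau> i)) powr p * ?w i)"
      using ex_sorted_norm_formula[where w = ?w and n = "Suc N" and y = "block_coeffs \<theta> p x N", OF p power_weight_nonneg
        antimono_power_weight] \<theta> by (auto simp: block_coeffs_def)
    then obtain \<tau> where \<tau>: "\<tau> permutes {..<Suc N}"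
        and sorted: "\<And>s t. s \<le> t \<Longrightarrow> t < Suc N \<Longrightarrow> norm (block_coeffs \<theta> p x N (\<tau> t)) \<le> norm (block_coeffs \<theta> p x N (\<tau> s))"
        and norm_\<tau>: "?s N = (\<Sum>i<Suc N. norm (block_coeffs \<theta> p x N (\<tau> i)) powr p * ?w i)"
      by blast
    have \<tau>_le: "\<tau> i \<le> N" if "i < Suc N" for i using permutes_in_image[OF \<tau>, of i] that by simp
    define a where "a i = norm (x (position N (\<tau> i) 0)) powr p" for i
    have a: "norm (block_coeffs \<theta> p x N (\<tau> i)) powr p = real ?K powr (1 - \<theta>) * a i" if "i < Suc N" for i
      using norm_block_coeffs_powr[OF p \<tau>_le[OF that]] by (simp add: a_def)
    have a_mono: "a t \<le> a s" if st: "s \<le> t" "t < Suc N" for s t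
    proof -
      have "norm (block_coeffs \<theta> p x N (\<tau> t)) powr p \<le> norm (block_coeffs \<theta> p x N (\<tau> s)) powr p"
        using sorted[OF st] p by (intro powr_mono2) auto
      then have "real ?K powr (1 - \<theta>) * a t \<le> real ?K powr (1 - \<theta>) * a s"
        using a[of t] a[of s] st by simp
      then show ?thesis by simp
    qed
    \<comment> \<open>In sorted order the \<open>s\<close>-th entry of the level lies in the block \<open>\<tau> (s div ?K)\<close>, and \<open>\<pi>\<close> sends
      it to the position \<open>\<sigma> s\<close>.\<close>
    define \<sigma> where "\<sigma> s = \<pi> (position N (\<tau> (s div ?K)) (s mod ?K))" for s
    have div: "s div ?K < Suc N" if "s < Suc N * ?K" for s using that by (rule less_mult_imp_div_less)
    have "inj_on \<sigma> {..<Suc N * ?K}"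
    proof
      fix s t assume st: "s \<in> {..<Suc N * ?K}" "t \<in> {..<Suc N * ?K}" "\<sigma> s = \<sigma> t"
      let ?c = "\<lambda>s. position N (\<tau> (s div ?K)) (s mod ?K)"
      have eq: "?c s = ?c t" using st(3) bij_is_inj[OF \<pi>] by (simp add: \<sigma>_def inj_eq)
      have c: "slot (?c s) = \<tau> (s div ?K)" "offset (?c s) = s mod ?K" if "s \<in> {..<Suc N * ?K}" for s
        using that div[of s] by (intro position_coordinates \<tau>_le; simp)+
      have "\<tau> (s div ?K) = \<tau> (t div ?K)" "s mod ?K = t mod ?K"
        using c[OF st(1)] c[OF st(2)] eq by simp_all
      then show "s = t" using permutes_inj[OF \<tau>] by (metis injD div_mult_mod_eq)
    qed
    then have rearr: "(\<Sum>s<Suc N * ?K. a (s div ?K) * ?w (\<sigma> s)) \<le> (\<Sum>s<Suc N * ?K. a (s div ?K) * ?w s)"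
      using div \<theta> by (intro rearrangement_inequality antimono_power_weight a_mono div_le_mono) (auto simp: a_def)
    have "(\<Sum>i<Suc N. \<Sum>t<?K. norm (x (position N i t)) powr p * ?w (\<pi> (position N i t)))
        = (\<Sum>i<Suc N. \<Sum>t<?K. norm (x (position N (\<tau> i) t)) powr p * ?w (\<pi> (position N (\<tau> i) t)))"
      using sum.permute[OF \<tau>, of "\<lambda>i. \<Sum>t<?K. norm (x (position N i t)) powr p * ?w (\<pi> (position N i t))"]
      by (simp add: o_def)
    also have "\<dots> = (\<Sum>i<Suc N. \<Sum>t<?K. a i * ?w (\<pi> (position N (\<tau> i) t)))"
    proof (intro sum.cong refl)
      fix i t assume "i \<in> {..<Suc N}" "t \<in> {..<?K}"
      then show "norm (x (position N (\<tau> i) t)) powr p * ?w (\<pi> (position N (\<tau> i) t)) = a i * ?w (\<pi> (position N (\<tau> i) t))"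
        using block_constant_position[OF x \<tau>_le[of i], of t] by (simp add: a_def)
    qed
    also have "\<dots> = (\<Sum>s<Suc N * ?K. a (s div ?K) * ?w (\<sigma> s))"
      unfolding \<sigma>_def by (rule sum_div_mod[symmetric])
    also note rearr
    also have "(\<Sum>s<Suc N * ?K. a (s div ?K) * ?w s)
        = (\<Sum>i<Suc N. \<Sum>s\<in>{i * ?K..<i * ?K + ?K}. a (s div ?K) * ?w s)"
      by (rule sum.nat_group[symmetric])
    also have "\<dots> = (\<Sum>i<Suc N. a i * (\<Sum>s\<in>{i * ?K..<i * ?K + ?K}. ?w s))"
    proof (rule sum.cong[OF refl])
      fix i
      have "s div ?K = i" if "s \<in> {i * ?K..<i * ?K + ?K}" for s
        using that by (intro div_nat_eqI) (auto simp: mult.commute)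
      then show "(\<Sum>s\<in>{i * ?K..<i * ?K + ?K}. a (s div ?K) * ?w s) = a i * (\<Sum>s\<in>{i * ?K..<i * ?K + ?K}. ?w s)"
        unfolding sum_distrib_left by (intro sum.cong) auto
    qed
    also have "\<dots> \<le> (\<Sum>i<Suc N. a i * (2 / (1 - \<theta>) * (real ?K powr (1 - \<theta>) * ?w i)))"
      using \<theta> by (intro sum_mono mult_left_mono sum_power_weight_block_le) (auto simp: a_def)
    also have "\<dots> = (\<Sum>i<Suc N. 2 / (1 - \<theta>) * (norm (block_coeffs \<theta> p x N (\<tau> i)) powr p * ?w i))"
      by (intro sum.cong refl) (simp add: a)
    also have "\<dots> = 2 / (1 - \<theta>) * ?s N" by (simp only: norm_\<tau> sum_distrib_left)
    finally show ?thesis .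
  qed
  obtain n where n: "F \<subseteq> {j. level j \<in> {..<n}}"
  proof
    have "level j \<le> Max (level ` F)" if "j \<in> F" for j using F that by simp
    then show "F \<subseteq> {j. level j \<in> {..<Suc (Max (level ` F))}}" by (auto simp: less_Suc_eq_le)
  qed
  have "(\<Sum>j\<in>F. norm (x j) powr p * ?w (\<pi> j)) \<le> (\<Sum>j | level j \<in> {..<n}. norm (x j) powr p * ?w (\<pi> j))"
    using n sum_levels(1)[OF finite_lessThan] by (intro sum_mono2) (auto simp: power_weight_nonneg)
  also have "\<dots> \<le> (\<Sum>N<n. 2 / (1 - \<theta>) * ?s N)"
    unfolding sum_levels(2)[OF finite_lessThan] by (rule sum_mono[OF group])
  also have "\<dots> = 2 / (1 - \<theta>) * (\<Sum>N<n. ?s N)" by (simp only: sum_distrib_left)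
  also have "\<dots> \<le> 2 / (1 - \<theta>) * suminf ?s"
    using \<theta> sm by (intro mult_left_mono sum_le_suminf) auto
  finally show "(\<Sum>j\<in>F. norm (x j) powr p * ?w (\<pi> j)) \<le> 2 / (1 - \<theta>) * suminf ?s" .
qed

section \<open>The complemented copy of the direct sum\<close>

definition assemble :: "real \<Rightarrow> real \<Rightarrow> (nat \<Rightarrow> nat \<Rightarrow> 'k::real_normed_field) \<Rightarrow> nat \<Rightarrow> 'k" where
  "assemble \<theta> p y j = y (level j) (slot j) / of_real (block_factor \<theta> p (level j))"

lemma block_constant_assemble: "block_constant (assemble \<theta> p y)"
  by (simp add: block_constant_def block_def assemble_def)

lemma block_coeffs_assemble:
  assumes "\<And>N i. N < i \<Longrightarrow> y N i = 0"
  shows "block_coeffs \<theta> p (assemble \<theta> p y) = (y :: nat \<Rightarrow> nat \<Rightarrow> 'k::real_normed_field)"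
proof (intro ext)
  fix N i
  show "block_coeffs \<theta> p (assemble \<theta> p y) N i = y N i"
    using assms[of N i] block_factor_pos[of \<theta> p N] by (simp add: block_coeffs_def assemble_def position_coordinates)
qed

text \<open>
  The projection is the blockwise average and the isomorphism is the map to the block coefficients. The
  argument is the same over every normed field.
\<close>

lemma complemented_copy_of_Y_space:
  fixes p \<theta> :: real
  assumes p: "1 \<le> p" and \<theta>: "0 < \<theta>" "\<theta> < 1"
  shows "\<exists>Z. one_complemented (lorentz (power_weight \<theta>) p :: ('k::real_normed_field, nat \<Rightarrow> 'k) normed_sp) Z \<and>
    isomorphic_sp ((lorentz (power_weight \<theta>) p)\<lparr>pts := Z\<rparr>)
      (Y_space (power_weight \<theta>) p :: ('k, nat \<Rightarrow> nat \<Rightarrow> 'k) normed_sp)"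
proof -
  let ?w = "power_weight \<theta>"
  let ?X = "lorentz ?w p :: ('k, nat \<Rightarrow> 'k) normed_sp"
  let ?Y = "Y_space ?w p :: ('k, nat \<Rightarrow> nat \<Rightarrow> 'k) normed_sp"
  let ?T = "block_coeffs \<theta> p :: (nat \<Rightarrow> 'k) \<Rightarrow> nat \<Rightarrow> nat \<Rightarrow> 'k"
  let ?s = "\<lambda>y N. nrm ?X (y N) powr p"
  define C where "C = 2 / (1 - \<theta>)"
  have C: "0 \<le> C" using \<theta> by (simp add: C_def)
  have p0: "0 < p" using p by simp
  have w: "\<And>n. 0 \<le> ?w n" "antimono ?w" "0 < ?w 0"
    using power_weight_nonneg antimono_power_weight[of \<theta>] \<theta> by (simp_all add: power_weight_0)
  define Z where "Z = {x \<in> pts ?X. block_constant x}"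
  let ?Z = "?X\<lparr>pts := Z\<rparr>"
  have "one_complemented ?X {x \<in> pts ?X. \<forall>j. \<forall>l\<in>block j. x l = x j}"
    using \<theta> by (intro one_complemented_blockwise_average p w power_weight_0 power_weight_le_1 finite_block block_0)
      (auto simp: block_def)
  then have comp: "one_complemented ?X Z" by (simp add: Z_def block_constant_def)
  have X: "normed_group ?X" using p w by (intro normed_group_lorentz)
  have Zg: "normed_group ?Z"
  proof (rule normed_group_subspace[OF X])
    show "Z \<subseteq> pts ?X" by (auto simp: Z_def)
    show "0 \<in> Z" using normed_groupD(1)[OF X] by (simp add: Z_def block_constant_def)
    show "- x \<in> Z" if "x \<in> Z" for x
      using that normed_groupD(2)[OF X] by (simp add: Z_def block_constant_def)
    show "x + y \<in> Z" if "x \<in> Z" "y \<in> Z" for x y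
      using that normed_groupD(6)[OF X] by (simp add: Z_def block_constant_def)
  qed
  have Yg: "normed_group ?Y"
    unfolding Y_space_def by (rule normed_group_lp_sum[OF p normed_group_lorentz_initial[OF p w]])
  have pts_Y: "y \<in> pts ?Y \<longleftrightarrow> (\<forall>N i. N < i \<longrightarrow> y N i = 0) \<and> summable (?s y)" for y
    by (auto simp: Y_space_def lp_sum_def pts_lorentz_initial nrm_lorentz_initial Suc_le_eq)
  have nrm_Y: "nrm ?Y y powr p = suminf (?s y)" if "y \<in> pts ?Y" for y
  proof -
    have "0 \<le> suminf (?s y)" using that by (intro suminf_nonneg) (auto simp: pts_Y)
    then show ?thesis using p0 by (simp add: Y_space_def lp_sum_def nrm_lorentz_initial powr_powr_inverse)
  qed
  have root: "a \<le> c powr (1 / p) * b" if "a powr p \<le> c * b powr p" "0 \<le> a" "0 \<le> b" "0 \<le> c" for a b c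
  proof -
    have "(a powr p) powr (1 / p) \<le> (c * b powr p) powr (1 / p)" using that p0 by (intro powr_mono2) auto
    then show ?thesis using that p0 by (simp add: powr_mult powr_powr)
  qed
  have upper: "?T x \<in> pts ?Y \<and> nrm ?Y (?T x) \<le> 2 powr (1 / p) * nrm ?X x" if x: "x \<in> Z" for x
  proof -
    have xX: "x \<in> pts ?X" and xc: "block_constant x" using x by (auto simp: Z_def)
    note out = rearranged_sums_le_of_lorentz[OF p0 w(1) xX]
    have bound: "(\<Sum>N<n. ?s (?T x) N) \<le> 2 * nrm ?X x powr p" for n
      by (rule sum_nrm_block_coeffs_le[OF p0 \<theta> xc out(2)])
    have "summable (?s (?T x))" by (rule summableI_nonneg_bounded[OF _ bound]) simp
    then have mem: "?T x \<in> pts ?Y" by (simp add: pts_Y block_coeffs_def)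
    have "nrm ?Y (?T x) powr p \<le> 2 * nrm ?X x powr p"
      unfolding nrm_Y[OF mem] using \<open>summable (?s (?T x))\<close> bound by (rule suminf_le_const)
    then show ?thesis using mem root out(1) normed_groupD(4)[OF Yg mem] by simp
  qed
  have lower: "x \<in> pts ?X \<and> nrm ?X x \<le> C powr (1 / p) * nrm ?Y (?T x)"
    if x: "block_constant x" and Tx: "?T x \<in> pts ?Y" for x
  proof -
    have *: "rearranged_sums_le ?w p x (C * nrm ?Y (?T x) powr p)"
      unfolding nrm_Y[OF Tx] C_def using Tx by (intro rearranged_sums_le_of_block_coeffs p0 \<theta> x) (simp add: pts_Y)
    note into = lorentz_of_rearranged_sums_le[OF p0 w(1) *]
    show ?thesis using into root C normed_groupD(4)[OF X into(1)] normed_groupD(4)[OF Yg Tx] by simp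
  qed
  have onto: "?T ` Z = pts ?Y"
  proof
    show "?T ` Z \<subseteq> pts ?Y" using upper by blast
    show "pts ?Y \<subseteq> ?T ` Z"
    proof
      fix y assume y: "y \<in> pts ?Y"
      let ?x = "assemble \<theta> p y :: nat \<Rightarrow> 'k"
      have Tx: "?T ?x = y" using y by (intro block_coeffs_assemble) (simp add: pts_Y)
      then have "?x \<in> Z" using lower[OF block_constant_assemble] y block_constant_assemble by (simp add: Z_def)
      then show "y \<in> ?T ` Z" using Tx by (metis image_eqI)
    qed
  qed
  have lin: "linear_map ?Z ?Y ?T"
    unfolding linear_map_def
  proof (intro conjI ballI allI)
    show "?T \<in> pts ?Z \<rightarrow> pts ?Y" using upper by simp
    show "?T (x + y) = ?T x + ?T y" for x y by (simp add: block_coeffs_def fun_eq_iff distrib_left)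
    show "?T (scl ?Z c x) = scl ?Y c (?T x)" for c x
      by (simp add: block_coeffs_def fun_eq_iff Y_space_def lp_sum_def lorentz_initial_def lorentz_def seq_scale_def)
  qed
  have "isomorphic_sp ?Z ?Y"
    by (rule isomorphic_spI[OF Zg Yg lin, of "2 powr (1 / p)" "C powr (1 / p)"])
      (use onto upper lower in \<open>auto simp: Z_def\<close>)
  then show ?thesis using comp by (intro exI[of _ Z] conjI)
qed

theorem corollary3p6:
  fixes p \<theta> :: real
  assumes "1 \<le> p" and "0 < \<theta>" and "\<theta> < 1"
  shows
    "(\<exists>Z. one_complemented (lorentz (power_weight \<theta>) p :: (real, nat \<Rightarrow> real) normed_sp) Z \<and>
          isomorphic_sp ((lorentz (power_weight \<theta>) p)\<lparr>pts := Z\<rparr>)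
            (Y_space (power_weight \<theta>) p :: (real, nat \<Rightarrow> nat \<Rightarrow> real) normed_sp)) \<and>
     (\<exists>Z. one_complemented (lorentz (power_weight \<theta>) p :: (complex, nat \<Rightarrow> complex) normed_sp) Z \<and>
          isomorphic_sp ((lorentz (power_weight \<theta>) p)\<lparr>pts := Z\<rparr>)
            (Y_space (power_weight \<theta>) p :: (complex, nat \<Rightarrow> nat \<Rightarrow> complex) normed_sp))"
  by (intro conjI complemented_copy_of_Y_space assms)

end
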